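(* Let $g\colon U\to V$ be a morphism of Lie algebras over a field of characteristic $0$, $T=U\oplus V$, and $n\ge2$. For $\theta\in C^{n-1}_{\mathbf{Lie}_{B\to W}}(T;T)$, corresponding to $(\theta_U,\theta_V,\theta_g)\in\Lambda^n(U,V)$, $$\delta(\theta_U,\theta_V,\theta_g)=\big(b\theta_U,\ b\theta_V,\ -b\theta_g+\theta_Vg^{\otimes n}-g\theta_U\big),$$ where $b$ denotes the appropriate Chevalley–Eilenberg differential and $\delta$ is the differential on $\Lambda^*(U,V)$ induced by $\delta_{\mathbf{Lie}_{B\to W}}$.
   Context: $\mathbf k$ is a field of characteristic $0$; $(U,\mu_U)$, $(V,\mu_V)$ are Lie algebras over $\mathbf k$ with brackets $\mu_U,\mu_V$, and $g\colon U\to V$ is a Lie algebra morphism. $T=U\oplus V$ is two-colored with $T_B=U$, $T_W=V$; $\mathrm{End}_T$ is its 2-colored endomorphism PROP (multilinear maps between tensor products of $U$'s and $V$'s). **Minimal model.** $\mathbf{Lie}_{B\to W}$ is the 2-colored operad whose algebras are morphisms of Lie algebras. Its minimal model is $(\mathsf F(E),\partial)$, the free 2-colored PROP on the 2-colored $\Sigma$-bimodule $E$ with skew-symmetric generators $\mu_n\colon B^{\otimes n}\to B$ of degree $n-2$ ($n\ge2$), $\nu_n\colon W^{\otimes n}\to W$ of degree $n-2$ ($n\ge2$), $f_n\colon B^{\otimes n}\to W$ of degree $n-1$ ($n\ge1$), and $$\partial(\mu_n)=\sum_{\substack{i+j=n+1\\ i,j\ge2}}(-1)^{j(i-1)}\sum_{\sigma\in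 S_{j,i-1}}\mathrm{sgn}(\sigma)\,\mu_i\circ(\mu_j\otimes\mathrm{Id}^{\otimes i-1})\circ\sigma,$$ $\partial(\nu_n)$ is given by the same formula with $\nu$ in place of $\mu$, and $$\begin{aligned}\partial(f_n)={}&\sum_{l=2}^n\sum_{\substack{r_1+\cdots+r_l=n\\ r_1\le\cdots\le r_l}}(-1)^{\frac{l(l-1)}2+\sum_{i=1}^{l-1}r_i(l-i)}\sum_{\sigma\in S^<_{r_1,\ldots,r_l}}\mathrm{sgn}(\sigma)\,\nu_l(f_{r_1}\otimes\cdots\otimes f_{r_l})\circ\sigma\\&-\sum_{\substack{i+j=n+1\\ i\ge1,j\ge2}}(-1)^{j(i-1)}\sum_{\sigma\in S_{j,i-1}}\mathrm{sgn}(\sigma)\,f_i\circ(\mu_j\otimes\mathrm{Id}^{\otimes i-1})\circ\sigma.\end{aligned}$$ Here $S_{j,i-1}$ is the set of $(j,i-1)$-unshuffles ($\sigma(1)<\cdots<\sigma(j)$, $\sigma(j+1)<\cdots<\sigma(j+i-1)$), $S^<_{r_1,\ldots,r_l}$ ($r_1\le\cdots\le r_l$) is the set of $(r_1,\ldots,r_l)$-unshuffles with $\sigma(r_1+\cdots+r_{i-1}+1)<\sigma(r_1+\cdots+r_i+1)$ whenever $r_i=r_{i+1}$, and $(F\circ\sigma)(x_1,\ldots,x_n)=F(x_{\sigma(1)},\ldots,x_{\sigma(n)})$. The morphism $g$ corresponds to $\beta\colon\mathsf F(E)\to\mathrm{End}_T$ with $\beta(\mu_2)=\mu_U$, $\beta(\nu_2)=\mu_V$,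 $\beta(f_1)=g$, and $\beta=0$ on all other generators. **Deformation complex.** $C^*_{\mathbf{Lie}_{B\to W}}(T;T)=\,\uparrow\mathrm{Der}(\mathsf F(E),\mathrm{End}_T)^{-*}\cong\,\uparrow\mathrm{Hom}_\Sigma(E,\mathrm{End}_T)^{-*}$ ($\uparrow$ suspension, $-*$ reversed grading; derivations are with respect to $\beta$): $\theta\in C^p$ ($p\ge1$) is a color-preserving equivariant linear map $E\to\mathrm{End}_T$ supported on generators of degree $p-1$, and is identified with $(\theta_U,\theta_V,\theta_g):=(\theta(\mu_{p+1}),\theta(\nu_{p+1}),\theta(f_p))\in\Lambda^{p+1}(U,V)$, where $$\Lambda^n(U,V)=\mathrm{Hom}(U^{\wedge n},U)\oplus\mathrm{Hom}(V^{\wedge n},V)\oplus\mathrm{Hom}(U^{\wedge n-1},V).$$ The differential $\delta_{\mathbf{Lie}_{B\to W}}=l_1$ is induced by $\theta\mapsto\theta\partial$: $l_1(\theta)(\xi)$, for a generator $\xi$, is the sum over all terms of $\partial(\xi)$ and all vertices $v$ of that term of the composite in $\mathrm{End}_T$ obtained by applying $\theta$ to the decoration of $v$ and $\beta$ to the other decorations (no signs other than the coefficients in $\partial(\xi)$). $\delta$ is the differential transported to $\Lambda^{*}(U,V)$ through the identification. **Chevalley–Eilenberg differential (sign convention).** For $\varphi\in\mathrm{Hom}(A^{\wedge n},M)$, $A$ a Lie algebra and $M$ a left $A$-module, $$(b\varphi)(x_1,\ldots,x_{n+1})=\sum_{1\le s\le n+1}(-1)^s\,x_s\cdot\varphi(x_1,\ldots,\widehat{x_s},\ldots,x_{n+1})+\sum_{1\le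 s<t\le n+1}(-1)^{s+t-1}\varphi([x_s,x_t],x_1,\ldots,\widehat{x_s},\ldots,\widehat{x_t},\ldots,x_{n+1}).$$ It is applied with $A=M=U$, $A=M=V$ (adjoint modules), and $A=U$, $M=V$, where $V$ is a $U$-module via $g$. *)

theory Defs
  imports Complex_Main "HOL-Library.Poly_Mapping" "HOL-Combinatorics.Permutations"
begin

section \<open>Lie algebras over a field\<close>

locale lie_algebra = vector_space scale
  for scale :: "'k::field \<Rightarrow> 'a::ab_group_add \<Rightarrow> 'a" +
  fixes bracket :: "'a \<Rightarrow> 'a \<Rightarrow> 'a"
  assumes linear_left: "\<And>y. Vector_Spaces.linear scale scale (\<lambda>x. bracket x y)"
    and linear_right: "\<And>x. Vector_Spaces.linear scale scale (bracket x)"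
    and bracket_self: "\<And>x. bracket x x = 0"
    and jacobi: "\<And>x y z.
      bracket x (bracket y z) + bracket y (bracket z x) + bracket z (bracket x y) = 0"

locale lie_morphism =
  dom: lie_algebra sU brU + cod: lie_algebra sV brV
  for sU :: "'k::field \<Rightarrow> 'u::ab_group_add \<Rightarrow> 'u" and brU
    and sV :: "'k \<Rightarrow> 'v::ab_group_add \<Rightarrow> 'v" and brV +
  fixes g :: "'u \<Rightarrow> 'v"
  assumes linear_g: "Vector_Spaces.linear sU sV g"
    and bracket_g: "\<And>x y. g (brU x y) = brV (g x) (g y)"


section \<open>Multilinear and skew-symmetric maps\<close>

text \<open>
  An \<open>n\<close>-ary operation is a function on lists that is normalised to be \<open>0\<close> on all lists whose
  length is not \<open>n\<close>, so that equality of functions is equality of \<open>n\<close>-ary operations.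
  \<open>permute_list \<sigma> xs\<close> is \<open>(x\<^bsub>\<sigma>(1)\<^esub>, \<dots>, x\<^bsub>\<sigma>(n)\<^esub>)\<close> (with indices counted from \<open>0\<close>).
\<close>

definition multilinear ::
    "('k::field \<Rightarrow> 'a::ab_group_add \<Rightarrow> 'a) \<Rightarrow> ('k \<Rightarrow> 'm::ab_group_add \<Rightarrow> 'm) \<Rightarrow> nat \<Rightarrow>
     ('a list \<Rightarrow> 'm) \<Rightarrow> bool" where
  "multilinear sA sM n \<phi> \<longleftrightarrow>
     (\<forall>xs k. length xs = n \<and> k < n \<longrightarrow> Vector_Spaces.linear sA sM (\<lambda>y. \<phi> (xs[k := y])))"

definition skew_symmetric ::
    "('k::field \<Rightarrow> 'm::ab_group_add \<Rightarrow> 'm) \<Rightarrow> nat \<Rightarrow> ('a list \<Rightarrow> 'm) \<Rightarrow> bool" where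
  "skew_symmetric sM n \<phi> \<longleftrightarrow>
     (\<forall>xs \<sigma>. length xs = n \<and> \<sigma> permutes {..<n} \<longrightarrow>
        \<phi> (permute_list \<sigma> xs) = sM (of_int (sign \<sigma>)) (\<phi> xs))"

text \<open>
  \<open>Hom(A\<^sup>\<and>\<^sup>n, M)\<close>; over a field of characteristic \<open>0\<close>, skew-symmetric and alternating maps agree.
\<close>

definition Hom_wedge ::
    "('k::field \<Rightarrow> 'a::ab_group_add \<Rightarrow> 'a) \<Rightarrow> ('k \<Rightarrow> 'm::ab_group_add \<Rightarrow> 'm) \<Rightarrow> nat \<Rightarrow>
     ('a list \<Rightarrow> 'm) set" where
  "Hom_wedge sA sM n =
     {\<phi>. multilinear sA sM n \<phi> \<and> skew_symmetric sM n \<phi> \<and> (\<forall>xs. length xs \<noteq> n \<longrightarrow> \<phi> xs = 0)}"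

definition Lambda ::
    "('k::field \<Rightarrow> 'u::ab_group_add \<Rightarrow> 'u) \<Rightarrow> ('k \<Rightarrow> 'v::ab_group_add \<Rightarrow> 'v) \<Rightarrow> nat \<Rightarrow>
     (('u list \<Rightarrow> 'u) \<times> ('v list \<Rightarrow> 'v) \<times> ('u list \<Rightarrow> 'v)) set" where
  "Lambda sU sV n = Hom_wedge sU sU n \<times> Hom_wedge sV sV n \<times> Hom_wedge sU sV (n - 1)"


section \<open>The Chevalley--Eilenberg differential\<close>

text \<open>
  The indices \<open>s\<close>, \<open>t\<close> are counted from \<open>1\<close>; \<open>act\<close> is the action of \<open>A\<close> on \<open>M\<close>, and
  \<open>nths xs (- J)\<close> is \<open>xs\<close> with the entries at the (\<open>0\<close>-based) positions in \<open>J\<close> omitted.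
\<close>

definition CE ::
    "('k::field \<Rightarrow> 'm::ab_group_add \<Rightarrow> 'm) \<Rightarrow> ('a \<Rightarrow> 'a \<Rightarrow> 'a) \<Rightarrow> ('a \<Rightarrow> 'm \<Rightarrow> 'm) \<Rightarrow> nat \<Rightarrow>
     ('a list \<Rightarrow> 'm) \<Rightarrow> ('a list \<Rightarrow> 'm)" where
  "CE sM br act n \<phi> xs =
     (if length xs = n + 1 then
        (\<Sum>s\<in>{1..n+1}. sM ((-1) ^ s) (act (xs ! (s - 1)) (\<phi> (nths xs (- {s - 1}))))) +
        (\<Sum>(s, t)\<in>{(s, t). 1 \<le> s \<and> s < t \<and> t \<le> n + 1}.
           sM ((-1) ^ (s + t - 1))
             (\<phi> (br (xs ! (s - 1)) (xs ! (t - 1)) # nths xs (- {s - 1, t - 1}))))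
      else 0)"


section \<open>The minimal model of the operad of Lie algebra morphisms\<close>

text \<open>
  Decorated trees representing the elements of the free 2-coloured PROP with one output, of
  colour \<open>B\<close> resp. \<open>W\<close>. \<open>In_B i\<close>, \<open>In_W i\<close> stand for the \<open>i\<close>-th input (from \<open>0\<close>);
  \<open>Mu [t\<^sub>1, \<dots>, t\<^sub>n]\<close> is a vertex decorated by \<open>\<mu>\<^sub>n\<close> with \<open>t\<^sub>1, \<dots>, t\<^sub>n\<close> plugged into its inputs, and
  similarly \<open>Nu\<close> and \<open>F\<close> for \<open>\<nu>\<^sub>n\<close> and \<open>f\<^sub>n\<close>: the arity of a generator is the length of the list.
  Inputs are not vertices. Thus \<open>G(G\<^sub>1 \<otimes> \<dots> \<otimes> G\<^sub>l) \<circ> \<sigma>\<close> is the tree whose inputs read from left to right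
  are \<open>\<sigma>(1), \<dots>, \<sigma>(n)\<close>. The skew-symmetry of the generators is not imposed on trees;
  it is built into the maps out of the generators below.
\<close>

datatype btree = In_B nat | Mu "btree list"

datatype wtree = In_W nat | Nu "wtree list" | F "btree list"

text \<open>
  Unshuffles, as permutations of \<open>{0, \<dots>, n - 1}\<close> increasing on each of the consecutive blocks of
  lengths \<open>r\<^sub>1, \<dots>, r\<^sub>l\<close>.
\<close>

definition block_start :: "nat list \<Rightarrow> nat \<Rightarrow> nat" where
  "block_start r k = sum_list (take k r)"

definition unshuffles :: "nat list \<Rightarrow> (nat \<Rightarrow> nat) set" where
  "unshuffles r =
     {\<sigma>. \<sigma> permutes {..<sum_list r} \<and>
         (\<forall>k<length r. strict_mono_on {block_start r k..<block_start r (k + 1)} \<sigma>)}"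

definition ordered_unshuffles :: "nat list \<Rightarrow> (nat \<Rightarrow> nat) set" where
  "ordered_unshuffles r =
     {\<sigma> \<in> unshuffles r. \<forall>k. k + 1 < length r \<and> r ! k = r ! (k + 1) \<longrightarrow>
        \<sigma> (block_start r k) < \<sigma> (block_start r (k + 1))}"

text \<open>
  \<open>\<Sum>\<^bsub>i+j=n+1, i\<ge>i0, j\<ge>2\<^esub> (-1)\<^sup>j\<^sup>(\<^sup>i\<^sup>-\<^sup>1\<^sup>) \<Sum>\<^sub>\<sigma> sgn(\<sigma>) out\<^sub>i \<circ> (inn\<^sub>j \<otimes> Id\<^sup>\<otimes>\<^sup>i\<^sup>-\<^sup>1) \<circ> \<sigma>\<close> as a formal linear combination
  of trees, which occurs in the boundaries of all three families of generators.
\<close>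

definition infinitesimal_sum ::
    "('b list \<Rightarrow> 't) \<Rightarrow> ('b list \<Rightarrow> 'b) \<Rightarrow> (nat \<Rightarrow> 'b) \<Rightarrow> nat \<Rightarrow> nat \<Rightarrow> ('t \<Rightarrow>\<^sub>0 'k::field)" where
  "infinitesimal_sum out inn leaf i0 n =
     (\<Sum>(i, j)\<in>{(i, j). i + j = n + 1 \<and> i0 \<le> i \<and> 2 \<le> j}.
        \<Sum>\<sigma>\<in>unshuffles [j, i - 1].
          Poly_Mapping.single
            (out (inn (map (\<lambda>a. leaf (\<sigma> a)) [0..<j]) # map (\<lambda>a. leaf (\<sigma> a)) [j..<n]))
            ((-1) ^ (j * (i - 1)) * of_int (sign \<sigma>)))"

definition bd_mu :: "nat \<Rightarrow> (btree \<Rightarrow>\<^sub>0 'k::field)" where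
  "bd_mu n = infinitesimal_sum Mu Mu In_B 2 n"

definition bd_nu :: "nat \<Rightarrow> (wtree \<Rightarrow>\<^sub>0 'k::field)" where
  "bd_nu n = infinitesimal_sum Nu Nu In_W 2 n"

definition bd_f :: "nat \<Rightarrow> (wtree \<Rightarrow>\<^sub>0 'k::field)" where
  "bd_f n =
     (\<Sum>l\<in>{2..n}. \<Sum>r\<in>{r. length r = l \<and> sum_list r = n \<and> sorted r \<and> (\<forall>a\<in>set r. 1 \<le> a)}.
        \<Sum>\<sigma>\<in>ordered_unshuffles r.
          Poly_Mapping.single
            (Nu (map (\<lambda>k. F (map (\<lambda>a. In_B (\<sigma> a)) [block_start r k..<block_start r (k + 1)])) [0..<l]))
            ((-1) ^ (l * (l - 1) div 2 + (\<Sum>i\<in>{1..l-1}. r ! (i - 1) * (l - i))) *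
             of_int (sign \<sigma>)))
     - infinitesimal_sum F Mu In_B 1 n"


section \<open>Evaluation of decorated trees in the endomorphism PROP\<close>

text \<open>
  A colour-preserving map from the generators to the endomorphism PROP of \<open>U \<oplus> V\<close>:
  the images of \<open>\<mu>\<^sub>n\<close>, \<open>\<nu>\<^sub>n\<close> and \<open>f\<^sub>n\<close>.
\<close>

record ('u, 'v) gen_map =
  on_mu :: "nat \<Rightarrow> 'u list \<Rightarrow> 'u"
  on_nu :: "nat \<Rightarrow> 'v list \<Rightarrow> 'v"
  on_f :: "nat \<Rightarrow> 'u list \<Rightarrow> 'v"

text \<open>
  A vertex is addressed by the path leading to it from the root. In \<open>eval_B d x t\<close> the decoration of
  the vertex \<open>p\<close> is interpreted by the map \<open>d p\<close>; \<open>x\<close> and \<open>y\<close> are the values of the inputs of colour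
  \<open>B\<close> and \<open>W\<close>.
\<close>

lemma size_nth_less [termination_simp]: "k < length ts \<Longrightarrow> size (ts ! k) < Suc (size_list size ts)"
  by (metis less_Suc_eq_le nth_mem order_refl size_list_estimation')

fun vertices_B :: "btree \<Rightarrow> nat list set" where
  "vertices_B (In_B i) = {}"
| "vertices_B (Mu ts) = insert [] (\<Union>k\<in>{..<length ts}. (#) k ` vertices_B (ts ! k))"

fun vertices_W :: "wtree \<Rightarrow> nat list set" where
  "vertices_W (In_W i) = {}"
| "vertices_W (Nu ts) = insert [] (\<Union>k\<in>{..<length ts}. (#) k ` vertices_W (ts ! k))"
| "vertices_W (F ts) = insert [] (\<Union>k\<in>{..<length ts}. (#) k ` vertices_B (ts ! k))"

fun eval_B :: "(nat list \<Rightarrow> ('u, 'v) gen_map) \<Rightarrow> (nat \<Rightarrow> 'u) \<Rightarrow> btree \<Rightarrow> 'u" where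
  "eval_B d x (In_B i) = x i"
| "eval_B d x (Mu ts) =
     on_mu (d []) (length ts) (map (\<lambda>k. eval_B (\<lambda>p. d (k # p)) x (ts ! k)) [0..<length ts])"

fun eval_W :: "(nat list \<Rightarrow> ('u, 'v) gen_map) \<Rightarrow> (nat \<Rightarrow> 'u) \<Rightarrow> (nat \<Rightarrow> 'v) \<Rightarrow> wtree \<Rightarrow> 'v" where
  "eval_W d x y (In_W i) = y i"
| "eval_W d x y (Nu ts) =
     on_nu (d []) (length ts) (map (\<lambda>k. eval_W (\<lambda>p. d (k # p)) x y (ts ! k)) [0..<length ts])"
| "eval_W d x y (F ts) =
     on_f (d []) (length ts) (map (\<lambda>k. eval_B (\<lambda>p. d (k # p)) x (ts ! k)) [0..<length ts])"

definition linear_extension ::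
    "('k::field \<Rightarrow> 'm::ab_group_add \<Rightarrow> 'm) \<Rightarrow> ('t \<Rightarrow> 'm) \<Rightarrow> ('t \<Rightarrow>\<^sub>0 'k) \<Rightarrow> 'm" where
  "linear_extension sM e c = (\<Sum>t\<in>Poly_Mapping.keys c. sM (Poly_Mapping.lookup c t) (e t))"


section \<open>The deformation complex\<close>

text \<open>The map \<open>\<beta>\<close> corresponding to \<open>g : U \<rightarrow> V\<close>.\<close>

definition beta ::
    "('u::ab_group_add \<Rightarrow> 'u \<Rightarrow> 'u) \<Rightarrow> ('v::ab_group_add \<Rightarrow> 'v \<Rightarrow> 'v) \<Rightarrow> ('u \<Rightarrow> 'v) \<Rightarrow>
     ('u, 'v) gen_map" where
  "beta brU brV g =
     \<lparr> on_mu = (\<lambda>n xs. if n = 2 \<and> length xs = 2 then brU (xs ! 0) (xs ! 1) else 0),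
       on_nu = (\<lambda>n xs. if n = 2 \<and> length xs = 2 then brV (xs ! 0) (xs ! 1) else 0),
       on_f = (\<lambda>n xs. if n = 1 \<and> length xs = 1 then g (xs ! 0) else 0) \<rparr>"

text \<open>
  The cochains of degree \<open>p \<ge> 1\<close>: equivariance amounts to skew-symmetry of the images of the
  generators, and the map is supported on the generators of degree \<open>p - 1\<close>, where \<open>\<mu>\<^sub>m\<close> and \<open>\<nu>\<^sub>m\<close> have
  degree \<open>m - 2\<close> (\<open>m \<ge> 2\<close>) and \<open>f\<^sub>m\<close> has degree \<open>m - 1\<close> (\<open>m \<ge> 1\<close>). At indices \<open>m\<close> that do not belong
  to a generator the components are normalised to \<open>0\<close>.
\<close>

definition cochains ::
    "('k::field \<Rightarrow> 'u::ab_group_add \<Rightarrow> 'u) \<Rightarrow> ('k \<Rightarrow> 'v::ab_group_add \<Rightarrow> 'v) \<Rightarrow> nat \<Rightarrow>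
     ('u, 'v) gen_map set" where
  "cochains sU sV p =
     {\<theta>. (\<forall>m\<ge>2. on_mu \<theta> m \<in> Hom_wedge sU sU m) \<and>
         (\<forall>m\<ge>2. on_nu \<theta> m \<in> Hom_wedge sV sV m) \<and>
         (\<forall>m\<ge>1. on_f \<theta> m \<in> Hom_wedge sU sV m) \<and>
         (\<forall>m. on_mu \<theta> m \<noteq> (\<lambda>_. 0) \<longrightarrow> m \<ge> 2 \<and> int m - 2 = int p - 1) \<and>
         (\<forall>m. on_nu \<theta> m \<noteq> (\<lambda>_. 0) \<longrightarrow> m \<ge> 2 \<and> int m - 2 = int p - 1) \<and>
         (\<forall>m. on_f \<theta> m \<noteq> (\<lambda>_. 0) \<longrightarrow> m \<ge> 1 \<and> int m - 1 = int p - 1)}"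

definition to_Lambda ::
    "nat \<Rightarrow> ('u, 'v) gen_map \<Rightarrow> ('u list \<Rightarrow> 'u) \<times> ('v list \<Rightarrow> 'v) \<times> ('u list \<Rightarrow> 'v)" where
  "to_Lambda p \<theta> = (on_mu \<theta> (p + 1), on_nu \<theta> (p + 1), on_f \<theta> p)"

text \<open>
  The differential \<open>\<theta> \<mapsto> \<theta>\<partial>\<close>: sum over the trees in the boundary of a generator and over the vertices
  \<open>v\<close> of each tree, with \<open>\<theta>\<close> applied at \<open>v\<close> and \<open>\<beta>\<close> at the other vertices. All inputs of the trees
  have the same colour, so the values supplied for the inputs of the other colour are irrelevant.
\<close>

definition l1 ::
    "('k::field \<Rightarrow> 'u::ab_group_add \<Rightarrow> 'u) \<Rightarrow> ('k \<Rightarrow> 'v::ab_group_add \<Rightarrow> 'v) \<Rightarrow>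
     ('u, 'v) gen_map \<Rightarrow> ('u, 'v) gen_map \<Rightarrow> ('u, 'v) gen_map" where
  "l1 sU sV \<beta> \<theta> =
     \<lparr> on_mu = (\<lambda>m xs. if length xs = m then
           linear_extension sU
             (\<lambda>t. \<Sum>v\<in>vertices_B t. eval_B (\<lambda>p. if p = v then \<theta> else \<beta>) ((!) xs) t)
             (bd_mu m)
         else 0),
       on_nu = (\<lambda>m xs. if length xs = m then
           linear_extension sV
             (\<lambda>t. \<Sum>v\<in>vertices_W t. eval_W (\<lambda>p. if p = v then \<theta> else \<beta>) (\<lambda>_. 0) ((!) xs) t)
             (bd_nu m)
         else 0),
       on_f = (\<lambda>m xs. if length xs = m then
           linear_extension sV
             (\<lambda>t. \<Sum>v\<in>vertices_W t. eval_W (\<lambda>p. if p = v then \<theta> else \<beta>) ((!) xs) (\<lambda>_. 0) t)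
             (bd_f m)
         else 0) \<rparr>"

lemma to_Lambda_bij:
  fixes sU :: "'k::field \<Rightarrow> 'u::ab_group_add \<Rightarrow> 'u" and sV :: "'k \<Rightarrow> 'v::ab_group_add \<Rightarrow> 'v"
  assumes "p \<ge> 1"
  shows "bij_betw (to_Lambda p) (cochains sU sV p) (Lambda sU sV (p + 1))"
proof (rule bij_betw_imageI)
  show "inj_on (to_Lambda p) (cochains sU sV p)"
  proof (rule inj_onI)
    fix \<theta> \<theta>' :: "('u, 'v) gen_map"
    assume A: "\<theta> \<in> cochains sU sV p" "\<theta>' \<in> cochains sU sV p" "to_Lambda p \<theta> = to_Lambda p \<theta>'"
    have supp: "on_mu \<eta> m = (\<lambda>_. 0)" "on_nu \<eta> m = (\<lambda>_. 0)"
      if "\<eta> \<in> cochains sU sV p" "m \<noteq> p + 1" for \<eta> :: "('u, 'v) gen_map" and m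
    proof -
      have "int m - 2 \<noteq> int p - 1" using that(2) by linarith
      then show "on_mu \<eta> m = (\<lambda>_. 0)" "on_nu \<eta> m = (\<lambda>_. 0)"
        using that(1) unfolding cochains_def by blast+
    qed
    have supp': "on_f \<eta> m = (\<lambda>_. 0)"
      if "\<eta> \<in> cochains sU sV p" "m \<noteq> p" for \<eta> :: "('u, 'v) gen_map" and m
    proof -
      have "int m - 1 \<noteq> int p - 1" using that(2) by linarith
      then show ?thesis using that(1) unfolding cochains_def by blast
    qed
    have "on_mu \<theta> m = on_mu \<theta>' m" "on_nu \<theta> m = on_nu \<theta>' m" for m
      using A(3) supp[OF A(1), of m] supp[OF A(2), of m]
      by (cases "m = p + 1"; simp add: to_Lambda_def)+
    moreover have "on_f \<theta> m = on_f \<theta>' m" for m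
      using A(3) supp'[OF A(1), of m] supp'[OF A(2), of m]
      by (cases "m = p"; simp add: to_Lambda_def)
    ultimately show "\<theta> = \<theta>'" by (intro gen_map.equality ext) (simp_all)
  qed
next
  show "to_Lambda p ` cochains sU sV p = Lambda sU sV (p + 1)"
  proof (intro equalityI subsetI)
    fix z assume "z \<in> to_Lambda p ` cochains sU sV p"
    then show "z \<in> Lambda sU sV (p + 1)"
      using assms by (auto simp: cochains_def to_Lambda_def Lambda_def)
  next
    fix z :: "('u list \<Rightarrow> 'u) \<times> ('v list \<Rightarrow> 'v) \<times> ('u list \<Rightarrow> 'v)"
    assume z: "z \<in> Lambda sU sV (p + 1)"
    obtain a b c where [simp]: "z = (a, b, c)" by (cases z)
    have abc: "a \<in> Hom_wedge sU sU (p + 1)" "b \<in> Hom_wedge sV sV (p + 1)" "c \<in> Hom_wedge sU sV p"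
      using z by (auto simp: Lambda_def)
    have vs: "vector_space sU" "vector_space sV"
    proof -
      have "Vector_Spaces.linear sU sV (\<lambda>y. c ((replicate p 0)[0 := y]))"
        using abc(3) assms by (auto simp: Hom_wedge_def multilinear_def)
      then show "vector_space sU" "vector_space sV"
        by (auto simp: Vector_Spaces.linear_def)
    qed
    have zero: "(\<lambda>_. 0) \<in> Hom_wedge sA sM m"
      if "vector_space sA" "vector_space sM"
      for m and sA :: "'k \<Rightarrow> 'a::ab_group_add \<Rightarrow> 'a" and sM :: "'k \<Rightarrow> 'm::ab_group_add \<Rightarrow> 'm"
    proof -
      interpret vector_space_pair sA sM
        using that by (simp add: vector_space_pair_def)
      show ?thesis
        by (simp add: Hom_wedge_def multilinear_def skew_symmetric_def linear_zero)
    qed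
    note zero = zero[OF vs(1) vs(1)] zero[OF vs(2) vs(2)] zero[OF vs(1) vs(2)]
    define \<theta> where "\<theta> = \<lparr> on_mu = (\<lambda>m. if m = p + 1 then a else (\<lambda>_. 0)),
      on_nu = (\<lambda>m. if m = p + 1 then b else (\<lambda>_. 0)), on_f = (\<lambda>m. if m = p then c else (\<lambda>_. 0)) \<rparr>"
    have "\<theta> \<in> cochains sU sV p"
      using abc zero assms by (auto simp: cochains_def \<theta>_def split: if_splits)
    moreover have "to_Lambda p \<theta> = z"
      by (simp add: to_Lambda_def \<theta>_def)
    ultimately show "z \<in> to_Lambda p ` cochains sU sV p" by force
  qed
qed

text \<open>The differential transported to \<open>\<Lambda>\<^sup>n(U, V) \<rightarrow> \<Lambda>\<^sup>n\<^sup>+\<^sup>1(U, V)\<close>.\<close>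

definition delta ::
    "('k::field \<Rightarrow> 'u::ab_group_add \<Rightarrow> 'u) \<Rightarrow> ('u \<Rightarrow> 'u \<Rightarrow> 'u) \<Rightarrow>
     ('k \<Rightarrow> 'v::ab_group_add \<Rightarrow> 'v) \<Rightarrow> ('v \<Rightarrow> 'v \<Rightarrow> 'v) \<Rightarrow> ('u \<Rightarrow> 'v) \<Rightarrow> nat \<Rightarrow>
     ('u list \<Rightarrow> 'u) \<times> ('v list \<Rightarrow> 'v) \<times> ('u list \<Rightarrow> 'v) \<Rightarrow>
     ('u list \<Rightarrow> 'u) \<times> ('v list \<Rightarrow> 'v) \<times> ('u list \<Rightarrow> 'v)" where
  "delta sU brU sV brV g n z =
     to_Lambda n (l1 sU sV (beta brU brV g)
       (the_inv_into (cochains sU sV (n - 1)) (to_Lambda (n - 1)) z))"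

end

theory Submission
  imports Defs
begin

text \<open>
  Since \<open>\<theta>\<close> lives on \<open>\<mu>\<^sub>n\<close>, \<open>\<nu>\<^sub>n\<close>, \<open>f\<^bsub>n-1\<^esub>\<close> and \<open>\<beta>\<close> on \<open>\<mu>\<^sub>2\<close>, \<open>\<nu>\<^sub>2\<close>, \<open>f\<^sub>1\<close>, only the trees built from
  generators of these arities survive. A tree with a binary inner vertex decorated by \<open>\<beta>\<close> and \<open>\<theta>\<close> at the root contributes to the
  bracket part of the Chevalley--Eilenberg differential, the sum over \<open>(2, m)\<close>-unshuffles being a sum
  over pairs \<open>s < t\<close>. The trees with a binary root decorated by \<open>\<beta>\<close> contribute the action part, as sums
  over \<open>(m, 1)\<close>- or \<open>(1, m)\<close>-unshuffles. In the boundary of \<open>f\<^sub>n\<close> there remain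
  \<open>\<nu>\<^sub>n(f\<^sub>1 \<otimes> \<dots> \<otimes> f\<^sub>1)\<close> and \<open>f\<^sub>1(\<mu>\<^sub>n)\<close>, which give \<open>\<theta>\<^sub>V g\<^sup>\<otimes>\<^sup>n\<close> and \<open>- g \<theta>\<^sub>U\<close>.
\<close>

section \<open>Unshuffles\<close>

text \<open>The values along the interval form the sorted duplicate-free enumeration of the image,
  and such an enumeration is unique.\<close>

lemma strict_mono_on_image_unique:
  fixes f h :: "nat \<Rightarrow> nat"
  assumes "strict_mono_on {a..<b} f" "strict_mono_on {a..<b} h" "f ` {a..<b} = h ` {a..<b}"
    and "k \<in> {a..<b}"
  shows "f k = h k"
proof -
  have "sorted (map q [a..<b]) \<and> distinct (map q [a..<b])" if "strict_mono_on {a..<b} q" for q :: "nat \<Rightarrow> nat"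
  proof -
    have "sorted_wrt (<) (map q [a..<b])"
      by (auto simp: sorted_wrt_iff_nth_less intro!: strict_mono_onD[OF that])
    then show ?thesis by (simp add: strict_sorted_iff)
  qed
  then have "map f [a..<b] = map h [a..<b]"
    using assms by (intro sorted_distinct_set_unique) auto
  then show ?thesis using assms(4) by simp
qed

lemma permutes_image_Diff: "q permutes S \<Longrightarrow> q ` (S - B) = S - q ` B"
  by (simp add: image_set_diff permutes_inj permutes_image)

section \<open>Two-block unshuffles and the cycles parametrising them\<close>

lemma unshuffles_pair_iff:
  "\<sigma> \<in> unshuffles [j, i] \<longleftrightarrow>
     \<sigma> permutes {..<j + i} \<and> strict_mono_on {0..<j} \<sigma> \<and> strict_mono_on {j..<j + i} \<sigma>"
  by (auto simp: unshuffles_def block_start_def less_Suc_eq numeral_2_eq_2)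

text \<open>A permutation sends the second block onto the complement of the image of the first, so
  that image fixes both increasing blocks. The classifications below reduce to comparing such
  images.\<close>

lemma unshuffles_pair_eqI:
  assumes \<sigma>: "\<sigma> \<in> unshuffles [j, i]" and \<tau>: "\<tau> \<in> unshuffles [j, i]"
    and eq: "\<sigma> ` {0..<j} = \<tau> ` {0..<j}"
  shows "\<sigma> = \<tau>"
proof
  fix k
  have "{j..<j + i} = {..<j + i} - {0..<j}" by auto
  then have compl: "q ` {j..<j + i} = {..<j + i} - q ` {0..<j}" if "q permutes {..<j + i}" for q
    using permutes_image_Diff[OF that] by simp
  consider "k \<in> {0..<j}" | "k \<in> {j..<j + i}" | "k \<notin> {..<j + i}" by fastforce
  then show "\<sigma> k = \<tau> k"
  proof cases
    case 1
    then show ?thesis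
      using \<sigma> \<tau> eq by (auto simp: unshuffles_pair_iff intro: strict_mono_on_image_unique[of 0 j])
  next
    case 2
    then show ?thesis
      using \<sigma> \<tau> eq compl
      by (intro strict_mono_on_image_unique[of j "j + i"]) (auto simp: unshuffles_pair_iff)
  next
    case 3
    then show ?thesis using \<sigma> \<tau> by (simp add: unshuffles_pair_iff permutes_def)
  qed
qed

text \<open>For \<open>a \<le> s\<close>, as a rearrangement of arguments, this cycle pulls the
  entry at position \<open>s\<close> forward to position \<open>a\<close> and keeps the order of the
  others; its inverse pulls the entry at \<open>a\<close> back to \<open>s\<close>.\<close>

definition shift_cycle :: "nat \<Rightarrow> nat \<Rightarrow> nat \<Rightarrow> nat" where
  "shift_cycle a s k = (if k = a then s else if a < k \<and> k \<le> s then k - 1 else k)"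

lemma shift_cycle_refl: "shift_cycle a a = id"
  by (simp add: shift_cycle_def fun_eq_iff)

lemma shift_cycle_Suc:
  "a \<le> s \<Longrightarrow> shift_cycle a (Suc s) = Transposition.transpose s (Suc s) \<circ> shift_cycle a s"
  by (auto simp: shift_cycle_def fun_eq_iff Transposition.transpose_def)

text \<open>Raising \<open>s\<close> by one multiplies the cycle by one adjacent transposition, so
  it is a product of \<open>s - a\<close> of them.\<close>

lemma shift_cycle_permutes_sign:
  assumes "a \<le> s"
  shows "shift_cycle a s permutes {a..s} \<and> sign (shift_cycle a s) = (-1) ^ (s - a)"
  using assms
proof (induction s rule: dec_induct)
  case base
  then show ?case by (simp add: shift_cycle_refl id_def)
next
  case (step k)
  have c: "shift_cycle a k permutes {a..Suc k}"
    by (rule permutes_subset[OF conjunct1[OF step.IH]]) auto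
  have t: "Transposition.transpose k (Suc k) permutes {a..Suc k}"
    using step.hyps by (intro permutes_swap_id) auto
  have "sign (Transposition.transpose k (Suc k) \<circ> shift_cycle a k) = - ((-1) ^ (k - a))"
    using step.IH sign_compose[OF permutes_imp_permutation[OF _ t] permutes_imp_permutation[OF _ c]]
    by (simp add: sign_swap_id)
  with permutes_compose[OF c t] show ?case
    unfolding shift_cycle_Suc[OF step.hyps(1)] using step.hyps(1) by (simp add: Suc_diff_le comp_def)
qed

lemma shift_cycle_permutes: "a \<le> s \<Longrightarrow> s < n \<Longrightarrow> shift_cycle a s permutes {..<n}"
  using shift_cycle_permutes_sign[of a s] by (auto intro: permutes_subset)

lemma permutation_shift_cycle: "a \<le> s \<Longrightarrow> permutation (shift_cycle a s)"
  using shift_cycle_permutes_sign by (blast intro: permutes_imp_permutation)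

lemma sign_shift_cycle: "a \<le> s \<Longrightarrow> sign (shift_cycle a s) = (-1) ^ (s - a)"
  using shift_cycle_permutes_sign by blast

lemma inv_shift_cycle:
  assumes "s \<le> m"
  shows "inv (shift_cycle s m) k = (if k = m then s else if s \<le> k \<and> k < m then Suc k else k)"
proof (rule inv_f_eq)
  show "inj (shift_cycle s m)"
    using shift_cycle_permutes_sign[OF assms] by (blast intro: permutes_inj)
qed (use assms in \<open>auto simp: shift_cycle_def\<close>)

text \<open>The value at \<open>0\<close> can be prescribed and determines the increasing rest;
  reading it off also gives injectivity.\<close>

lemma unshuffles_1:
  "unshuffles [1, m] = shift_cycle 0 ` {..m}" and inj_on_unshuffles_1: "inj_on (shift_cycle 0) {..m}"
proof -
  have mem: "shift_cycle 0 s \<in> unshuffles [1, m]" if "s \<le> m" for s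
    unfolding unshuffles_pair_iff using shift_cycle_permutes[of 0 s "1 + m"] that
    by (auto simp: strict_mono_on_def shift_cycle_def)
  have "\<sigma> \<in> shift_cycle 0 ` {..m}" if "\<sigma> \<in> unshuffles [1, m]" for \<sigma>
  proof -
    have "\<sigma> 0 < 1 + m"
      using that permutes_in_image[of \<sigma> "{..<1+m}" 0] by (auto simp: unshuffles_pair_iff)
    then have "\<sigma> = shift_cycle 0 (\<sigma> 0)"
      by (intro unshuffles_pair_eqI[OF that mem]) (auto simp: shift_cycle_def)
    then show ?thesis using \<open>\<sigma> 0 < 1 + m\<close> by (metis atMost_iff image_eqI less_Suc_eq_le plus_1_eq_Suc)
  qed
  with mem show "unshuffles [1, m] = shift_cycle 0 ` {..m}" by blast
  show "inj_on (shift_cycle 0) {..m}"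
    by (rule inj_on_inverseI[where g = "\<lambda>\<sigma>. \<sigma> 0"]) (simp add: shift_cycle_def)
qed

text \<open>Dually, the value at the last position \<open>m\<close> can be prescribed, and the image
  of the first block is everything else.\<close>

lemma unshuffles_last:
  "unshuffles [m, 1] = (\<lambda>s. inv (shift_cycle s m)) ` {..m}"
  and inj_on_unshuffles_last: "inj_on (\<lambda>s. inv (shift_cycle s m)) {..m}"
proof -
  have mem: "inv (shift_cycle s m) \<in> unshuffles [m, 1]" if "s \<le> m" for s
    unfolding unshuffles_pair_iff using shift_cycle_permutes[of s m "m + 1"] that
    by (auto simp: strict_mono_on_def inv_shift_cycle intro: permutes_inv)
  have "\<sigma> \<in> (\<lambda>s. inv (shift_cycle s m)) ` {..m}" if "\<sigma> \<in> unshuffles [m, 1]" for \<sigma>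
  proof -
    have lt: "\<sigma> m < m + 1"
      using that permutes_in_image[of \<sigma> "{..<m+1}" m] by (auto simp: unshuffles_pair_iff)
    have "{0..<m} = {..<m + 1} - {m}" by auto
    then have img: "q ` {0..<m} = {..<m + 1} - {q m}" if "q permutes {..<m + 1}" for q
      using permutes_image_Diff[OF that, of "{m}"] by simp
    have mem': "inv (shift_cycle (\<sigma> m) m) \<in> unshuffles [m, 1]"
      using lt by (intro mem) simp
    have "\<sigma> ` {0..<m} = inv (shift_cycle (\<sigma> m) m) ` {0..<m}"
    proof -
      have "\<sigma> permutes {..<m + 1}" "inv (shift_cycle (\<sigma> m) m) permutes {..<m + 1}"
        using that mem' by (simp_all only: unshuffles_pair_iff)
      moreover have "inv (shift_cycle (\<sigma> m) m) m = \<sigma> m"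
        using lt by (simp add: inv_shift_cycle)
      ultimately show ?thesis by (simp only: img)
    qed
    then have "\<sigma> = inv (shift_cycle (\<sigma> m) m)"
      by (rule unshuffles_pair_eqI[OF that mem'])
    then show ?thesis using lt by (metis Suc_eq_plus1 atMost_iff image_eqI less_Suc_eq_le)
  qed
  with mem show "unshuffles [m, 1] = (\<lambda>s. inv (shift_cycle s m)) ` {..m}" by blast
  show "inj_on (\<lambda>s. inv (shift_cycle s m)) {..m}"
    by (rule inj_on_inverseI[where g = "\<lambda>\<sigma>. \<sigma> m"]) (simp add: inv_shift_cycle)
qed

text \<open>As a rearrangement, \<open>shift_cycle 0 s\<close> first pulls entry \<open>s\<close> to
  the front, leaving entry \<open>t\<close> in place because \<open>s < t\<close>; then
  \<open>shift_cycle 1 t\<close> pulls that one to position \<open>1\<close>. So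
  \<open>(s, t)\<close> are the values at \<open>0\<close> and \<open>1\<close>.\<close>

lemma unshuffles_2:
  "unshuffles [2, m] = (\<lambda>(s, t). shift_cycle 0 s \<circ> shift_cycle 1 t) ` {(s, t). s < t \<and> t < m + 2}"
  and inj_on_unshuffles_2:
  "inj_on (\<lambda>(s, t). shift_cycle 0 s \<circ> shift_cycle 1 t) {(s, t). s < t \<and> t < m + 2}"
proof -
  have mem: "shift_cycle 0 s \<circ> shift_cycle 1 t \<in> unshuffles [2, m]" if "s < t" "t < m + 2" for s t
  proof -
    have "shift_cycle 0 s \<circ> shift_cycle 1 t permutes {..<2 + m}"
      using that by (intro permutes_compose shift_cycle_permutes) auto
    then show ?thesis
      unfolding unshuffles_pair_iff using that
      by (auto simp: strict_mono_on_def shift_cycle_def)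
  qed
  have "\<sigma> \<in> (\<lambda>(s, t). shift_cycle 0 s \<circ> shift_cycle 1 t) ` {(s, t). s < t \<and> t < m + 2}"
    if "\<sigma> \<in> unshuffles [2, m]" for \<sigma>
  proof -
    have st: "\<sigma> 0 < \<sigma> 1" "\<sigma> 1 < m + 2"
      using that permutes_in_image[of \<sigma> "{..<2+m}" 1]
      by (auto simp: unshuffles_pair_iff strict_mono_on_def)
    have eq: "\<sigma> = shift_cycle 0 (\<sigma> 0) \<circ> shift_cycle 1 (\<sigma> 1)"
    proof (rule unshuffles_pair_eqI[OF that mem[OF st]])
      have "{0..<2::nat} = {0, 1}" by auto
      then show "\<sigma> ` {0..<2} = (shift_cycle 0 (\<sigma> 0) \<circ> shift_cycle 1 (\<sigma> 1)) ` {0..<2}"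
        using st by (simp add: shift_cycle_def insert_commute)
    qed
    show ?thesis
    proof (rule image_eqI)
      show "\<sigma> = (case (\<sigma> 0, \<sigma> 1) of (s, t) \<Rightarrow> shift_cycle 0 s \<circ> shift_cycle 1 t)"
        unfolding prod.case by (fact eq)
    qed (use st in simp)
  qed
  then show "unshuffles [2, m] =
    (\<lambda>(s, t). shift_cycle 0 s \<circ> shift_cycle 1 t) ` {(s, t). s < t \<and> t < m + 2}"
    by (intro equalityI subsetI) (auto simp: mem[unfolded One_nat_def])
  show "inj_on (\<lambda>(s, t). shift_cycle 0 s \<circ> shift_cycle 1 t) {(s, t). s < t \<and> t < m + 2}"
    by (rule inj_on_inverseI[where g = "\<lambda>\<sigma>. (\<sigma> 0, \<sigma> 1)"]) (auto simp: shift_cycle_def)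
qed

lemma unshuffles_0: "unshuffles [n, 0] = {id}"
proof -
  have "id \<in> unshuffles [n, 0]" by (simp add: unshuffles_pair_iff permutes_id strict_mono_on_def)
  moreover have "\<sigma> = id" if "\<sigma> \<in> unshuffles [n, 0]" for \<sigma>
  proof -
    have "\<sigma> permutes {..<n}" using that by (simp add: unshuffles_pair_iff)
    then have "\<sigma> ` {0..<n} = id ` {0..<n}" by (simp add: atLeast0LessThan permutes_image)
    then show ?thesis using that \<open>id \<in> _\<close> by (intro unshuffles_pair_eqI[of _ n 0])
  qed
  ultimately show ?thesis by blast
qed

lemma permutes_strict_mono_on_id:
  fixes \<sigma> :: "nat \<Rightarrow> nat"
  assumes "\<sigma> permutes {..<n}" "strict_mono_on {0..<n} \<sigma>"
  shows "\<sigma> = id"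
  using assms unshuffles_0[of n] by (auto simp: unshuffles_pair_iff strict_mono_on_def)

section \<open>Ordered unshuffles and increasing blocks\<close>

lemma block_start_replicate_1: "k \<le> n \<Longrightarrow> block_start (replicate n 1) k = k"
  by (simp add: block_start_def sum_list_replicate)

text \<open>All blocks have length one, so the ordering condition compares every two consecutive
  values. Hence the tree with \<open>\<nu>\<^sub>n\<close> over \<open>n\<close> copies of
  \<open>f\<^sub>1\<close> occurs once and not once per permutation.\<close>

lemma ordered_unshuffles_replicate_1: "ordered_unshuffles (replicate n 1) = {id}"
proof -
  have "strict_mono_on {0..<n} \<sigma>" if "\<sigma> \<in> ordered_unshuffles (replicate n 1)" for \<sigma>
  proof -
    have step: "\<sigma> k < \<sigma> (Suc k)" if "Suc k < n" for k
      using that \<open>\<sigma> \<in> _\<close> block_start_replicate_1[of k n] block_start_replicate_1[of "Suc k" n]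
      unfolding ordered_unshuffles_def by (auto dest!: spec[of _ k])
    have "i < j \<Longrightarrow> j < n \<Longrightarrow> \<sigma> i < \<sigma> j" for i j
      by (induction j) (use step in \<open>auto simp: less_Suc_eq dest: Suc_lessD intro: less_trans\<close>)
    then show ?thesis by (auto simp: strict_mono_on_def)
  qed
  then have "\<sigma> = id" if "\<sigma> \<in> ordered_unshuffles (replicate n 1)" for \<sigma>
    using that by (intro permutes_strict_mono_on_id[of _ n])
      (auto simp: ordered_unshuffles_def unshuffles_def sum_list_replicate)
  moreover have "id \<in> ordered_unshuffles (replicate n 1)"
    by (auto simp: ordered_unshuffles_def unshuffles_def permutes_id strict_mono_on_def block_start_def)
  ultimately show ?thesis by blast
qed

text \<open>The ordering condition compares blocks of equal length, and here the lengths are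
  \<open>1\<close> and \<open>m\<close>; the case \<open>m = 1\<close> is treated apart in
  \<open>l1_f_binary\<close>.\<close>

lemma ordered_unshuffles_1: "m \<noteq> 1 \<Longrightarrow> ordered_unshuffles [1, m] = unshuffles [1, m]"
  by (auto simp: ordered_unshuffles_def)

text \<open>Both lists read \<open>xs\<close> along the sorted enumeration of \<open>A\<close>
  within the index range. This turns a block of an unshuffle into a list with omitted entries, the
  form used in \<open>CE\<close>.\<close>

lemma map_nth_strict_mono_on_eq_nths:
  assumes "strict_mono_on {a..<b} \<sigma>" "\<sigma> ` {a..<b} = A \<inter> {..<length xs}"
  shows "map (\<lambda>k. xs ! \<sigma> k) [a..<b] = nths xs A"
proof -
  have "map \<sigma> [a..<b] = filter (\<lambda>k. k \<in> A) [0..<length xs]"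
  proof (rule sorted_distinct_set_unique)
    have "sorted_wrt (<) (map \<sigma> [a..<b])"
      by (auto simp: sorted_wrt_iff_nth_less intro!: strict_mono_onD[OF assms(1)])
    then show "sorted (map \<sigma> [a..<b])" "distinct (map \<sigma> [a..<b])"
      by (simp_all add: strict_sorted_iff)
  qed (use assms(2) in \<open>auto intro: sorted_filter[of id, simplified]\<close>)
  moreover have "filter (\<lambda>k. k \<in> A) [0..<m] = nths [0..<m] A" for m
    by (induction m) (simp_all add: nths_append)
  ultimately have "map ((!) xs) (map \<sigma> [a..<b]) = nths (map ((!) xs) [0..<length xs]) A"
    by (simp add: nths_map)
  then show ?thesis by (simp add: map_nth comp_def)
qed

section \<open>Sums over unshuffles and linear extension\<close>

lemma linear_map_add: "Vector_Spaces.linear s1 s2 f \<Longrightarrow> f (x + y) = f x + f y"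
  by (simp add: Vector_Spaces.linear_iff)

lemma linear_map_zero:
  assumes "Vector_Spaces.linear s1 s2 f"
  shows "f 0 = 0"
  using linear_map_add[OF assms, of 0 0] by simp

context lie_algebra
begin

lemma bracket_zero_left [simp]: "bracket 0 y = 0"
  using linear_map_zero[OF linear_left] .

lemma bracket_zero_right [simp]: "bracket x 0 = 0"
  using linear_map_zero[OF linear_right] .

lemma bracket_antisym: "bracket x y = - bracket y x"
proof -
  have "bracket (x + y) (x + y) = bracket x x + bracket y x + (bracket x y + bracket y y)"
    by (simp add: linear_map_add[OF linear_left] linear_map_add[OF linear_right])
  then have "bracket x y + bracket y x = 0"
    by (simp add: bracket_self algebra_simps)
  then show ?thesis by (simp add: eq_neg_iff_add_eq_0)
qed

end

lemma Hom_wedge_zero_Cons: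
  assumes "\<phi> \<in> Hom_wedge sA sM n" "n \<noteq> 0"
  shows "\<phi> (0 # zs) = 0"
proof (cases "Suc (length zs) = n")
  case True
  have "\<forall>xs k. length xs = n \<and> k < n \<longrightarrow> Vector_Spaces.linear sA sM (\<lambda>y. \<phi> (xs[k := y]))"
    using assms(1) by (simp add: Hom_wedge_def multilinear_def)
  from this[rule_format, of "0 # zs" 0] True
  have "Vector_Spaces.linear sA sM (\<lambda>y. \<phi> ((0 # zs)[0 := y]))" by simp
  from linear_map_zero[OF this] show ?thesis by simp
qed (use assms in \<open>auto simp: Hom_wedge_def\<close>)

section \<open>Formal linear combinations of trees\<close>

context vector_space
begin

text \<open>Cancellation can make the keys of a sum smaller than the union of the keys; a common
  finite superset allows \<open>c + d\<close>, \<open>c\<close> and \<open>d\<close> to be summed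
  over one index set.\<close>

lemma linear_extension_superset:
  assumes "finite S" "Poly_Mapping.keys c \<subseteq> S"
  shows "linear_extension scale e c = (\<Sum>t\<in>S. scale (Poly_Mapping.lookup c t) (e t))"
  unfolding linear_extension_def
  using assms by (intro sum.mono_neutral_left) (auto simp: in_keys_iff)

lemma linear_extension_zero [simp]: "linear_extension scale e 0 = 0"
  by (simp add: linear_extension_def)

lemma linear_extension_add:
  "linear_extension scale e (c + d) = linear_extension scale e c + linear_extension scale e d"
proof -
  let ?S = "Poly_Mapping.keys c \<union> Poly_Mapping.keys d"
  have "Poly_Mapping.keys (c + d) \<subseteq> ?S" by (rule Poly_Mapping.keys_add)
  then show ?thesis
    by (simp add: linear_extension_superset[of ?S] lookup_add scale_left_distrib sum.distrib)
qed

lemma linear_extension_diff: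
  "linear_extension scale e (c - d) = linear_extension scale e c - linear_extension scale e d"
  using linear_extension_add[of e "c - d" d] by simp

lemma linear_extension_sum:
  "linear_extension scale e (\<Sum>i\<in>I. c i) = (\<Sum>i\<in>I. linear_extension scale e (c i))"
  by (induction I rule: infinite_finite_induct) (simp_all add: linear_extension_add)

lemma linear_extension_single [simp]:
  "linear_extension scale e (Poly_Mapping.single t a) = scale a (e t)"
  by (simp add: linear_extension_def)

section \<open>Signed sums over unshuffles as sums over omitted positions\<close>

lemma sum_unshuffles_1:
  "(\<Sum>\<sigma>\<in>unshuffles [1, m]. scale (of_int (sign \<sigma>)) (h \<sigma>)) =
    (\<Sum>s\<in>{1..m + 1}. scale ((-1) ^ (s - 1)) (h (shift_cycle 0 (s - 1))))"
proof -
  have "(\<Sum>\<sigma>\<in>unshuffles [1, m]. scale (of_int (sign \<sigma>)) (h \<sigma>)) =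
    (\<Sum>s\<in>{..m}. scale ((-1) ^ s) (h (shift_cycle 0 s)))"
    unfolding unshuffles_1 by (simp add: sum.reindex[OF inj_on_unshuffles_1] sign_shift_cycle)
  also have "\<dots> = (\<Sum>s\<in>{1..m + 1}. scale ((-1) ^ (s - 1)) (h (shift_cycle 0 (s - 1))))"
    by (rule sum.reindex_bij_witness[of _ "\<lambda>s. s - 1" Suc]) auto
  finally show ?thesis .
qed

text \<open>The factor \<open>(-1) ^ m\<close> is the boundary coefficient
  \<open>(-1) ^ (j * (i - 1))\<close> for \<open>j = m\<close> and \<open>i = 2\<close>; together
  with the sign \<open>(-1) ^ (m - s)\<close> of the cycle it leaves \<open>(-1) ^ s\<close>, for
  \<open>s\<close> counted from \<open>0\<close>.\<close>

lemma sum_unshuffles_last: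
  "(\<Sum>\<sigma>\<in>unshuffles [m, 1]. scale ((-1) ^ m * of_int (sign \<sigma>)) (h \<sigma>)) =
    (\<Sum>s\<in>{1..m + 1}. scale ((-1) ^ (s - 1)) (h (inv (shift_cycle (s - 1) m))))"
proof -
  have "((-1) ^ m * (-1) ^ (m - s) :: 'a) = (-1) ^ s" if "s \<le> m" for s
  proof -
    have "m + (m - s) = s + 2 * (m - s)" using that by simp
    then show ?thesis by (metis minus_one_power_iff even_add even_mult_iff even_numeral power_add)
  qed
  then have "(\<Sum>\<sigma>\<in>unshuffles [m, 1]. scale ((-1) ^ m * of_int (sign \<sigma>)) (h \<sigma>)) =
    (\<Sum>s\<in>{..m}. scale ((-1) ^ s) (h (inv (shift_cycle s m))))"
    unfolding unshuffles_last
    by (simp add: sum.reindex[OF inj_on_unshuffles_last] sign_inverse permutation_shift_cycle sign_shift_cycle)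
  also have "\<dots> = (\<Sum>s\<in>{1..m + 1}. scale ((-1) ^ (s - 1)) (h (inv (shift_cycle (s - 1) m))))"
    by (rule sum.reindex_bij_witness[of _ "\<lambda>s. s - 1" Suc]) auto
  finally show ?thesis .
qed

text \<open>With positions counted from \<open>0\<close> the two cycles have signs
  \<open>(-1) ^ s\<close> and \<open>(-1) ^ (t - 1)\<close>; counting from \<open>1\<close> changes
  the total exponent by two.\<close>

lemma sum_unshuffles_2:
  "(\<Sum>\<sigma>\<in>unshuffles [2, m]. scale (of_int (sign \<sigma>)) (h \<sigma>)) =
    (\<Sum>(s, t)\<in>{(s, t). 1 \<le> s \<and> s < t \<and> t \<le> m + 2}.
      scale ((-1) ^ (s + t - 1)) (h (shift_cycle 0 (s - 1) \<circ> shift_cycle 1 (t - 1))))"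
proof -
  have "sign (shift_cycle 0 s \<circ> shift_cycle 1 t) = (-1) ^ (s + (t - 1))" if "s < t" for s t
    using that
    by (simp add: sign_compose permutation_shift_cycle sign_shift_cycle del: Nat.add_diff_assoc flip: power_add)
  then have "(\<Sum>\<sigma>\<in>unshuffles [2, m]. scale (of_int (sign \<sigma>)) (h \<sigma>)) =
    (\<Sum>(s, t)\<in>{(s, t). s < t \<and> t < m + 2}.
      scale ((-1) ^ (s + (t - 1))) (h (shift_cycle 0 s \<circ> shift_cycle 1 t)))"
    unfolding unshuffles_2 by (subst sum.reindex[OF inj_on_unshuffles_2]) (auto intro!: sum.cong)
  also have "\<dots> = (\<Sum>(s, t)\<in>{(s, t). 1 \<le> s \<and> s < t \<and> t \<le> m + 2}.
      scale ((-1) ^ (s + t - 1)) (h (shift_cycle 0 (s - 1) \<circ> shift_cycle 1 (t - 1))))"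
  proof (rule sum.reindex_bij_witness[of _ "\<lambda>(s, t). (s - 1, t - 1)" "\<lambda>(s, t). (Suc s, Suc t)"])
    fix p :: "nat \<times> nat"
    assume p: "p \<in> {(s, t). s < t \<and> t < m + 2}"
    obtain s t where st: "p = (s, t)" "s < t" using p by auto
    \<comment> \<open>\<open>s < t\<close> makes \<open>t\<close> positive, so the truncated
      subtraction in the exponent is a true one.\<close>
    then obtain r where "t = Suc r" by (cases t) auto
    with st show "(case case p of (s, t) \<Rightarrow> (Suc s, Suc t) of
        (s, t) \<Rightarrow> scale ((-1) ^ (s + t - 1)) (h (shift_cycle 0 (s - 1) \<circ> shift_cycle 1 (t - 1)))) =
      (case p of (s, t) \<Rightarrow> scale ((-1) ^ (s + (t - 1))) (h (shift_cycle 0 s \<circ> shift_cycle 1 t)))"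
      by simp
  qed auto
  finally show ?thesis .
qed

text \<open>The remaining block is increasing with image the complement of the chosen position, so
  it is \<open>xs\<close> with that entry removed. The next two lemmas argue alike, with the last
  position or the first two singled out.\<close>

lemma sum_unshuffles_1_nths:
  assumes "length xs = m + 1"
  shows "(\<Sum>\<sigma>\<in>unshuffles [1, m]. scale (of_int (sign \<sigma>)) (h (xs ! \<sigma> 0) (map (\<lambda>a. xs ! \<sigma> a) [1..<m + 1]))) =
    (\<Sum>s\<in>{1..m + 1}. scale ((-1) ^ (s - 1)) (h (xs ! (s - 1)) (nths xs (- {s - 1}))))"
  unfolding sum_unshuffles_1
proof (rule sum.cong[OF refl])
  fix s assume s: "s \<in> {1..m + 1}"
  let ?\<sigma> = "shift_cycle 0 (s - 1)"
  have \<sigma>: "?\<sigma> \<in> unshuffles [1, m]" using s unfolding unshuffles_1 by (intro imageI) auto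
  then have "?\<sigma> ` ({..<1 + m} - {0}) = {..<1 + m} - {s - 1}"
    by (subst permutes_image_Diff) (auto simp: unshuffles_pair_iff shift_cycle_def)
  moreover have "{..<1 + m} - {0} = {1..<1 + m}" by auto
  ultimately have "map (\<lambda>a. xs ! ?\<sigma> a) [1..<1 + m] = nths xs (- {s - 1})"
    using \<sigma> assms by (intro map_nth_strict_mono_on_eq_nths) (auto simp: unshuffles_pair_iff)
  then show "scale ((-1) ^ (s - 1)) (h (xs ! ?\<sigma> 0) (map (\<lambda>a. xs ! ?\<sigma> a) [1..<m + 1])) =
    scale ((-1) ^ (s - 1)) (h (xs ! (s - 1)) (nths xs (- {s - 1})))"
    by (simp add: shift_cycle_def)
qed

lemma sum_unshuffles_last_nths:
  assumes "length xs = m + 1"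
  shows "(\<Sum>\<sigma>\<in>unshuffles [m, 1]. scale ((-1) ^ m * of_int (sign \<sigma>)) (h (xs ! \<sigma> m) (map (\<lambda>a. xs ! \<sigma> a) [0..<m]))) =
    (\<Sum>s\<in>{1..m + 1}. scale ((-1) ^ (s - 1)) (h (xs ! (s - 1)) (nths xs (- {s - 1}))))"
  unfolding sum_unshuffles_last
proof (rule sum.cong[OF refl])
  fix s assume s: "s \<in> {1..m + 1}"
  let ?\<sigma> = "inv (shift_cycle (s - 1) m)"
  have \<sigma>: "?\<sigma> \<in> unshuffles [m, 1]" using s unfolding unshuffles_last by (intro imageI) auto
  have last: "?\<sigma> m = s - 1" using s by (auto simp: inv_shift_cycle)
  have "?\<sigma> ` ({..<m + 1} - {m}) = {..<m + 1} - {s - 1}"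
    using \<sigma> last by (subst permutes_image_Diff) (auto simp: unshuffles_pair_iff)
  moreover have "{..<m + 1} - {m} = {0..<m}" by auto
  ultimately have "map (\<lambda>a. xs ! ?\<sigma> a) [0..<m] = nths xs (- {s - 1})"
    using \<sigma> assms by (intro map_nth_strict_mono_on_eq_nths) (auto simp: unshuffles_pair_iff)
  then show "scale ((-1) ^ (s - 1)) (h (xs ! ?\<sigma> m) (map (\<lambda>a. xs ! ?\<sigma> a) [0..<m])) =
    scale ((-1) ^ (s - 1)) (h (xs ! (s - 1)) (nths xs (- {s - 1})))"
    by (simp only: last)
qed

lemma sum_unshuffles_2_nths:
  assumes "length xs = m + 2"
  shows "(\<Sum>\<sigma>\<in>unshuffles [2, m]. scale (of_int (sign \<sigma>))
      (h (xs ! \<sigma> 0) (xs ! \<sigma> 1) (map (\<lambda>a. xs ! \<sigma> a) [2..<m + 2]))) =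
    (\<Sum>(s, t)\<in>{(s, t). 1 \<le> s \<and> s < t \<and> t \<le> m + 2}.
      scale ((-1) ^ (s + t - 1)) (h (xs ! (s - 1)) (xs ! (t - 1)) (nths xs (- {s - 1, t - 1}))))"
  unfolding sum_unshuffles_2
proof (rule sum.cong[OF refl], clarify)
  fix s t :: nat assume st: "1 \<le> s" "s < t" "t \<le> m + 2"
  let ?\<sigma> = "shift_cycle 0 (s - 1) \<circ> shift_cycle 1 (t - 1)"
  have \<sigma>: "?\<sigma> \<in> unshuffles [2, m]"
    using st unfolding unshuffles_2 by (intro image_eqI[where x = "(s - 1, t - 1)"]) auto
  have first: "?\<sigma> 0 = s - 1" "?\<sigma> 1 = t - 1" using st by (auto simp: shift_cycle_def)
  have "?\<sigma> ` ({..<2 + m} - {0, 1}) = {..<2 + m} - {?\<sigma> 0, ?\<sigma> 1}"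
    using \<sigma> by (subst permutes_image_Diff) (auto simp: unshuffles_pair_iff)
  moreover have "{..<2 + m} - {0, 1} = {2..<2 + m}" by auto
  ultimately have "?\<sigma> ` {2..<2 + m} = - {s - 1, t - 1} \<inter> {..<length xs}"
    unfolding first using assms by auto
  moreover have "strict_mono_on {2..<2 + m} ?\<sigma>" using \<sigma> unfolding unshuffles_pair_iff by blast
  ultimately have "map (\<lambda>a. xs ! ?\<sigma> a) [2..<2 + m] = nths xs (- {s - 1, t - 1})"
    by (intro map_nth_strict_mono_on_eq_nths)
  then show "scale ((-1) ^ (s + t - 1)) (h (xs ! ?\<sigma> 0) (xs ! ?\<sigma> 1) (map (\<lambda>a. xs ! ?\<sigma> a) [2..<m + 2])) =
    scale ((-1) ^ (s + t - 1)) (h (xs ! (s - 1)) (xs ! (t - 1)) (nths xs (- {s - 1, t - 1})))"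
    unfolding first by (simp only: add.commute)
qed

text \<open>Each tree has a root and one inner vertex, hence two ways to place \<theta>: in the
  applications \<open>P\<close>, \<open>q\<close> decorate root and inner vertex in one way,
  \<open>P'\<close>, \<open>q'\<close> in the other. The supports select the single index pairs
  \<open>(p, 2)\<close> and \<open>(k, m)\<close>. Abstract operations make one computation serve
  the boundaries of all three families.\<close>

lemma linear_extension_infinitesimal_sum:
  fixes e :: "'t \<Rightarrow> 'b" and P P' :: "nat \<Rightarrow> 'c::zero list \<Rightarrow> 'b"
  assumes e: "\<And>as bs. e (out (inn (map leaf as) # map leaf bs)) =
      P (Suc (length bs)) (q (length as) (map x as) # map x bs) +
      P' (Suc (length bs)) (q' (length as) (map x as) # map x bs)"
    and supp: "\<And>i. i \<noteq> p \<Longrightarrow> P i = (\<lambda>_. 0)" "\<And>j. j \<noteq> 2 \<Longrightarrow> q j = (\<lambda>_. 0)"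
      "\<And>i. i \<noteq> k \<Longrightarrow> P' i = (\<lambda>_. 0)" "\<And>j. j \<noteq> m \<Longrightarrow> q' j = (\<lambda>_. 0)"
    and zero: "\<And>zs. P p (0 # zs) = 0" "\<And>zs. P' k (0 # zs) = 0"
    and idx: "n = p + 1" "n + 1 = k + m" "2 \<le> m" "i0 \<le> p" "i0 \<le> k" "1 \<le> i0"
  shows "linear_extension scale e (infinitesimal_sum out inn leaf i0 n) =
    (\<Sum>\<sigma>\<in>unshuffles [2, p - 1]. scale (of_int (sign \<sigma>))
       (P p (q 2 [x (\<sigma> 0), x (\<sigma> 1)] # map (\<lambda>a. x (\<sigma> a)) [2..<n]))) +
    (\<Sum>\<sigma>\<in>unshuffles [m, k - 1]. scale ((-1) ^ (m * (k - 1)) * of_int (sign \<sigma>))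
       (P' k (q' m (map (\<lambda>a. x (\<sigma> a)) [0..<m]) # map (\<lambda>a. x (\<sigma> a)) [m..<n])))"
proof -
  let ?I = "{(i, j). i + j = n + 1 \<and> i0 \<le> i \<and> 2 \<le> j}"
  define G where "G = (\<lambda>R (r :: nat \<Rightarrow> 'c list \<Rightarrow> 'c) (i, j). \<Sum>\<sigma>\<in>unshuffles [j, i - 1].
    scale ((-1) ^ (j * (i - 1)) * of_int (sign \<sigma>))
      (R i (r j (map (\<lambda>a. x (\<sigma> a)) [0..<j]) # map (\<lambda>a. x (\<sigma> a)) [j..<n]) :: 'b))"
  have fin: "finite ?I" by (rule finite_subset[of _ "{..n + 1} \<times> {..n + 1}"]) auto
  have "e (out (inn (map (\<lambda>a. leaf (\<sigma> a)) [0..<j]) # map (\<lambda>a. leaf (\<sigma> a)) [j..<n])) =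
      P i (q j (map (\<lambda>a. x (\<sigma> a)) [0..<j]) # map (\<lambda>a. x (\<sigma> a)) [j..<n]) +
      P' i (q' j (map (\<lambda>a. x (\<sigma> a)) [0..<j]) # map (\<lambda>a. x (\<sigma> a)) [j..<n])"
    if "(i, j) \<in> ?I" for i j \<sigma>
  proof -
    \<comment> \<open>The root carries the inner vertex and \<open>n - j\<close> leaves, so its
      arity is \<open>i\<close>.\<close>
    have "Suc (n - j) = i" using that idx by auto
    then show ?thesis using e[of "map \<sigma> [0..<j]" "map \<sigma> [j..<n]"] by (simp add: comp_def)
  qed
  then have "linear_extension scale e (infinitesimal_sum out inn leaf i0 n) =
    (\<Sum>z\<in>?I. G P q z + G P' q' z)"
    unfolding infinitesimal_sum_def linear_extension_sum G_def
    by (intro sum.cong refl)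
      (auto simp: linear_extension_sum scale_right_distrib simp flip: sum.distrib intro!: sum.cong)
  also have "\<dots> = (\<Sum>z\<in>?I. G P q z) + (\<Sum>z\<in>?I. G P' q' z)" by (rule sum.distrib)
  also have "(\<Sum>z\<in>?I. G P q z) = (\<Sum>z\<in>{(p, 2)}. G P q z)"
  proof (rule sum.mono_neutral_right[OF fin])
    show "\<forall>z\<in>?I - {(p, 2)}. G P q z = 0"
    proof
      fix z assume z: "z \<in> ?I - {(p, 2)}"
      obtain i j where ij: "z = (i, j)" by (cases z)
      \<comment> \<open>As \<open>i + j\<close> is fixed, a pair other than \<open>(p, 2)\<close>
        differs from it in both entries, so the root operation vanishes.\<close>
      then have "j \<noteq> 2" "i \<noteq> p" using z idx by auto
      then show "G P q z = 0" by (simp add: ij G_def supp(1))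
    qed
  qed (use idx in auto)
  also have "(\<Sum>z\<in>?I. G P' q' z) = (\<Sum>z\<in>{(k, m)}. G P' q' z)"
  proof (rule sum.mono_neutral_right[OF fin])
    show "\<forall>z\<in>?I - {(k, m)}. G P' q' z = 0"
    proof
      fix z assume z: "z \<in> ?I - {(k, m)}"
      obtain i j where ij: "z = (i, j)" by (cases z)
      then have "j \<noteq> m" "i \<noteq> k" using z idx by auto
      then show "G P' q' z = 0" by (simp add: ij G_def supp(3))
    qed
  qed (use idx in auto)
  \<comment> \<open>The coefficient for \<open>(p, 2)\<close> has the even exponent
    \<open>2 * (p - 1)\<close>; \<open>upt_rec\<close> unfolds \<open>[0..<2]\<close> into the
    positions \<open>0\<close> and \<open>1\<close>.\<close>
  finally show ?thesis by (simp add: G_def power_mult upt_rec)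
qed

end

section \<open>Evaluation of the trees in the boundaries\<close>

lemma eval_B_corolla: "eval_B d x (Mu (map In_B as)) = on_mu (d []) (length as) (map x as)"
  by (auto intro!: arg_cong[where f = "on_mu _ _"] nth_equalityI)

lemma eval_B_graft:
  "eval_B d x (Mu (t # map In_B bs)) =
    on_mu (d []) (Suc (length bs)) (eval_B (\<lambda>p. d (0 # p)) x t # map x bs)"
  by (auto simp: map_upt_Suc simp del: upt_Suc intro!: arg_cong[where f = "on_mu _ _"] nth_equalityI)

lemma eval_W_corolla_F: "eval_W d x y (F (map In_B as)) = on_f (d []) (length as) (map x as)"
  by (auto intro!: arg_cong[where f = "on_f _ _"] nth_equalityI)

lemma eval_W_corolla_Nu: "eval_W d x y (Nu (map In_W as)) = on_nu (d []) (length as) (map y as)"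
  by (auto intro!: arg_cong[where f = "on_nu _ _"] nth_equalityI)

lemma eval_W_graft_F:
  "eval_W d x y (F (t # map In_B bs)) =
    on_f (d []) (Suc (length bs)) (eval_B (\<lambda>p. d (0 # p)) x t # map x bs)"
  by (auto simp: map_upt_Suc simp del: upt_Suc intro!: arg_cong[where f = "on_f _ _"] nth_equalityI)

lemma eval_W_graft_Nu:
  "eval_W d x y (Nu (t # map In_W bs)) =
    on_nu (d []) (Suc (length bs)) (eval_W (\<lambda>p. d (0 # p)) x y t # map y bs)"
  by (auto simp: map_upt_Suc simp del: upt_Suc intro!: arg_cong[where f = "on_nu _ _"] nth_equalityI)

lemma eval_W_Nu_F:
  "eval_W d x y (Nu (map (\<lambda>k. F (map In_B (as k))) [0..<l])) =
    on_nu (d []) l (map (\<lambda>k. on_f (d [k]) (length (as k)) (map x (as k))) [0..<l])"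
  by (auto simp: eval_W_corolla_F simp del: eval_W.simps(3) intro!: arg_cong[where f = "on_nu _ _"] nth_equalityI)

text \<open>Leaves contribute no vertices, so only the root and its first child can carry \<theta>;
  the same holds in the other two colourings.\<close>

lemma vertices_B_graft: "vertices_B (Mu (Mu (map In_B as) # map In_B bs)) = {[], [0]}"
  by (auto simp: nth_Cons split: nat.splits)

lemma vertices_W_graft_F: "vertices_W (F (Mu (map In_B as) # map In_B bs)) = {[], [0]}"
  by (auto simp: nth_Cons split: nat.splits)

lemma vertices_W_graft_Nu: "vertices_W (Nu (Nu (map In_W as) # map In_W bs)) = {[], [0]}"
  by (auto simp: nth_Cons split: nat.splits)

lemma vertices_W_Nu_F:
  "vertices_W (Nu (map (\<lambda>k. F (map In_B (as k))) [0..<l])) = insert [] ((\<lambda>k. [k]) ` {..<l})"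
  by auto

section \<open>Compositions, signs and vertex sums in the boundary of
  \<open>f\<^sub>n\<close>\<close>

lemma sum_list_eq_length_iff:
  assumes "\<forall>a\<in>set r. 1 \<le> a"
  shows "sum_list r = length r \<longleftrightarrow> r = replicate (length r) (1 :: nat)"
proof -
  have "length r \<le> sum_list r \<and> (sum_list r = length r \<longrightarrow> r = replicate (length r) 1)"
    using assms by (induction r) auto
  then show ?thesis by (metis mult.right_neutral of_nat_id sum_list_replicate)
qed

text \<open>Summed in reverse order, the second summand is again \<open>n * (n - 1) div 2\<close>,
  so the exponent is twice that number. This gives
  \<open>\<theta>\<^sub>V g\<^sup>\<otimes>\<^sup>n\<close> its plus sign.\<close>

lemma bd_f_corolla_sign: "even (n * (n - 1) div 2 + (\<Sum>i\<in>{1..n - 1}. replicate n 1 ! (i - 1) * (n - i)))"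
proof -
  have "(\<Sum>i\<in>{1..n - 1}. replicate n 1 ! (i - 1) * (n - i)) = (\<Sum>i\<in>{1..n - 1}. n - i)"
    by (rule sum.cong) auto
  also have "\<dots> = (\<Sum>i\<in>{1..n - 1}. i)"
    by (rule sum.reindex_bij_witness[of _ "\<lambda>i. n - i" "\<lambda>i. n - i"]) auto
  also have "\<dots> = n * (n - 1) div 2"
    using gauss_sum_from_Suc_0[of "n - 1", where 'a = nat] by (cases n) (simp_all add: mult.commute)
  finally show ?thesis by simp
qed

lemma bd_f_pair_compositions:
  assumes "r \<in> {r. length r = 2 \<and> sum_list r = n \<and> sorted r \<and> (\<forall>a\<in>set r. 1 \<le> a)}"
  obtains a b :: nat where "r = [a, b]" "a + b = n" "1 \<le> a" "a \<le> b"
  using assms by (auto simp: numeral_2_eq_2 length_Suc_conv)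

lemma finite_bd_f_pair_compositions:
  "finite {r :: nat list. length r = 2 \<and> sum_list r = n \<and> sorted r \<and> (\<forall>a\<in>set r. 1 \<le> a)}"
proof (rule finite_subset)
  show "{r. length r = 2 \<and> sum_list r = n \<and> sorted r \<and> (\<forall>a\<in>set r. 1 \<le> a)}
      \<subseteq> {r. set r \<subseteq> {..n} \<and> length r = 2}"
    by (auto dest: member_le_sum_list)
qed (simp add: finite_lists_length_eq)

text \<open>In this two-level tree \<theta> sits at the root or at the \<open>k\<close>-th child.
  The first summand is evaluated in \<open>l1_f_compositions\<close>, the second in
  \<open>l1_f_binary\<close>.\<close>

lemma sum_eval_W_Nu_F:
  fixes \<theta> \<beta> :: "('u, 'v::comm_monoid_add) gen_map"
  assumes T: "T = Nu (map (\<lambda>k. F (map (\<lambda>a. In_B (\<sigma> a)) (L k))) [0..<l])"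
  shows "(\<Sum>v\<in>vertices_W T. eval_W (\<lambda>p. if p = v then \<theta> else \<beta>) x y T) =
    on_nu \<theta> l (map (\<lambda>k. on_f \<beta> (length (L k)) (map (\<lambda>a. x (\<sigma> a)) (L k))) [0..<l]) +
    (\<Sum>k<l. on_nu \<beta> l (map (\<lambda>j. on_f (if j = k then \<theta> else \<beta>) (length (L j))
      (map (\<lambda>a. x (\<sigma> a)) (L j))) [0..<l]))"
proof -
  have T': "T = Nu (map (\<lambda>k. F (map In_B (map \<sigma> (L k)))) [0..<l])"
    by (simp add: T comp_def)
  have "inj_on (\<lambda>k. [k]) {..<l}" by (simp add: inj_on_def)
  moreover have "[] \<notin> (\<lambda>k. [k]) ` {..<l}" by auto
  ultimately show ?thesis
    unfolding T' vertices_W_Nu_F eval_W_Nu_F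
    by (simp add: sum.reindex comp_def)
qed

text \<open>Here \<phi> stands for \<theta> and \<psi> for \<beta>, in either colour. With \<phi> at
  the root the unshuffle chooses the pair to be bracketed; with \<psi> at the root it chooses the
  entry left over to act.\<close>

lemma (in lie_algebra) linear_extension_CE:
  fixes \<phi> \<psi> :: "nat \<Rightarrow> 'a list \<Rightarrow> 'a"
  assumes e: "\<And>as bs. e (out (inn (map leaf as) # map leaf bs)) =
      \<phi> (Suc (length bs)) (\<psi> (length as) (map ((!) xs) as) # map ((!) xs) bs) +
      \<psi> (Suc (length bs)) (\<phi> (length as) (map ((!) xs) as) # map ((!) xs) bs)"
    and \<phi>: "\<And>i. i \<noteq> n \<Longrightarrow> \<phi> i = (\<lambda>_. 0)" "\<And>zs. \<phi> n (0 # zs) = 0"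
    and \<psi>: "\<And>i. i \<noteq> 2 \<Longrightarrow> \<psi> i = (\<lambda>_. 0)" "\<And>zs. \<psi> 2 (0 # zs) = 0"
      "\<And>x y. \<psi> 2 [x, y] = bracket x y"
    and n: "2 \<le> n" and len: "length xs = n + 1"
  shows "linear_extension scale e (infinitesimal_sum out inn leaf 2 (n + 1)) =
    CE scale bracket bracket n (\<phi> n) xs"
proof -
  have m: "n - 1 + 2 = n + 1" using n by simp
  have "linear_extension scale e (infinitesimal_sum out inn leaf 2 (n + 1)) =
    (\<Sum>\<sigma>\<in>unshuffles [2, n - 1]. scale (of_int (sign \<sigma>))
       (\<phi> n (\<psi> 2 [xs ! \<sigma> 0, xs ! \<sigma> 1] # map (\<lambda>a. xs ! \<sigma> a) [2..<n + 1]))) +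
    (\<Sum>\<sigma>\<in>unshuffles [n, 2 - 1]. scale ((-1) ^ (n * (2 - 1)) * of_int (sign \<sigma>))
       (\<psi> 2 (\<phi> n (map (\<lambda>a. xs ! \<sigma> a) [0..<n]) # map (\<lambda>a. xs ! \<sigma> a) [n..<n + 1])))"
    \<comment> \<open>The instance is \<open>p = n\<close>, \<open>k = 2\<close> and
      \<open>m = n\<close>.\<close>
    by (rule linear_extension_infinitesimal_sum) (use n in \<open>simp_all add: e \<phi> \<psi>\<close>)
  also have "(\<Sum>\<sigma>\<in>unshuffles [2, n - 1]. scale (of_int (sign \<sigma>))
       (\<phi> n (\<psi> 2 [xs ! \<sigma> 0, xs ! \<sigma> 1] # map (\<lambda>a. xs ! \<sigma> a) [2..<n + 1]))) =
    (\<Sum>(s, t)\<in>{(s, t). 1 \<le> s \<and> s < t \<and> t \<le> n + 1}. scale ((-1) ^ (s + t - 1))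
       (\<phi> n (bracket (xs ! (s - 1)) (xs ! (t - 1)) # nths xs (- {s - 1, t - 1}))))"
    using sum_unshuffles_2_nths[of xs "n - 1" "\<lambda>x y zs. \<phi> n (bracket x y # zs)"] len
    by (simp only: m \<psi>(3))
  also have "(\<Sum>\<sigma>\<in>unshuffles [n, 2 - 1]. scale ((-1) ^ (n * (2 - 1)) * of_int (sign \<sigma>))
       (\<psi> 2 (\<phi> n (map (\<lambda>a. xs ! \<sigma> a) [0..<n]) # map (\<lambda>a. xs ! \<sigma> a) [n..<n + 1]))) =
    (\<Sum>s\<in>{1..n + 1}. scale ((-1) ^ (s - 1)) (bracket (\<phi> n (nths xs (- {s - 1}))) (xs ! (s - 1))))"
    using sum_unshuffles_last_nths[of xs n "\<lambda>x zs. bracket (\<phi> n zs) x"] len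
    by (simp add: \<psi>(3))
  \<comment> \<open>Grafting puts the value of \<phi> on the left of the bracket; antisymmetry moves
    it to the right and supplies the missing sign.\<close>
  also have "\<dots> = (\<Sum>s\<in>{1..n + 1}. scale ((-1) ^ s) (bracket (xs ! (s - 1)) (\<phi> n (nths xs (- {s - 1})))))"
  proof (rule sum.cong[OF refl])
    fix s assume "s \<in> {1..n + 1}"
    then obtain r where "s = Suc r" by (cases s) auto
    then show "scale ((-1) ^ (s - 1)) (bracket (\<phi> n (nths xs (- {s - 1}))) (xs ! (s - 1))) =
      scale ((-1) ^ s) (bracket (xs ! (s - 1)) (\<phi> n (nths xs (- {s - 1}))))"
      using bracket_antisym[of "xs ! r"] by simp
  qed
  finally show ?thesis using len by (simp add: CE_def add.commute)
qed

section \<open>The three components of the differential of a cochain\<close>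

context
  fixes sU :: "'k::field \<Rightarrow> 'u::ab_group_add \<Rightarrow> 'u" and \<mu>\<^sub>U
    and sV :: "'k \<Rightarrow> 'v::ab_group_add \<Rightarrow> 'v" and \<mu>\<^sub>V
    and g :: "'u \<Rightarrow> 'v" and n :: nat and \<theta> :: "('u, 'v) gen_map"
  assumes mor: "lie_morphism sU \<mu>\<^sub>U sV \<mu>\<^sub>V g"
    and n: "2 \<le> n"
    and \<theta>: "\<theta> \<in> cochains sU sV (n - 1)"
begin

interpretation lie_morphism sU \<mu>\<^sub>U sV \<mu>\<^sub>V g by (fact mor)

private abbreviation \<beta> where "\<beta> \<equiv> beta \<mu>\<^sub>U \<mu>\<^sub>V g"

lemma g_zero: "g 0 = 0"
  by (rule linear_map_zero[OF linear_g])

text \<open>The generators of degree \<open>n - 2\<close> have arity \<open>n\<close> in the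
  families \<mu> and \<nu>, and arity \<open>n - 1\<close> in the family \<open>f\<close>.\<close>

lemma theta_supp:
  "i \<noteq> n \<Longrightarrow> on_mu \<theta> i = (\<lambda>_. 0)" "i \<noteq> n \<Longrightarrow> on_nu \<theta> i = (\<lambda>_. 0)"
  "i \<noteq> n - 1 \<Longrightarrow> on_f \<theta> i = (\<lambda>_. 0)"
proof -
  have "i \<noteq> n \<Longrightarrow> int i - 2 \<noteq> int (n - 1) - 1" "i \<noteq> n - 1 \<Longrightarrow> int i - 1 \<noteq> int (n - 1) - 1"
    using n by linarith+
  then show "i \<noteq> n \<Longrightarrow> on_mu \<theta> i = (\<lambda>_. 0)" "i \<noteq> n \<Longrightarrow> on_nu \<theta> i = (\<lambda>_. 0)"
    "i \<noteq> n - 1 \<Longrightarrow> on_f \<theta> i = (\<lambda>_. 0)"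
    using \<theta> unfolding cochains_def by blast+
qed

lemma theta_Hom_wedge:
  "on_mu \<theta> n \<in> Hom_wedge sU sU n" "on_nu \<theta> n \<in> Hom_wedge sV sV n"
  "on_f \<theta> (n - 1) \<in> Hom_wedge sU sV (n - 1)"
  using \<theta> n by (auto simp: cochains_def)

lemma theta_zero_Cons:
  "on_mu \<theta> n (0 # zs) = 0" "on_nu \<theta> n (0 # ws) = 0" "on_f \<theta> (n - 1) (0 # zs) = 0"
  using theta_Hom_wedge n by (auto intro!: Hom_wedge_zero_Cons)

lemma beta_supp:
  "i \<noteq> 2 \<Longrightarrow> on_mu \<beta> i = (\<lambda>_. 0)" "i \<noteq> 2 \<Longrightarrow> on_nu \<beta> i = (\<lambda>_. 0)"
  "i \<noteq> 1 \<Longrightarrow> on_f \<beta> i = (\<lambda>_. 0)"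
  by (auto simp: beta_def)

lemma beta_values:
  "on_mu \<beta> 2 [a, b] = \<mu>\<^sub>U a b" "on_nu \<beta> 2 [c, d] = \<mu>\<^sub>V c d" "on_f \<beta> 1 [a] = g a"
  by (simp_all add: beta_def)

lemma beta_zero_Cons:
  "on_mu \<beta> 2 (0 # zs) = 0" "on_nu \<beta> 2 (0 # ws) = 0" "on_f \<beta> 1 (0 # zs) = 0"
  by (auto simp: beta_def g_zero nth_Cons split: nat.splits)

lemma l1_mu: "on_mu (l1 sU sV \<beta> \<theta>) (n + 1) = CE sU \<mu>\<^sub>U \<mu>\<^sub>U n (on_mu \<theta> n)"
proof
  fix xs
  show "on_mu (l1 sU sV \<beta> \<theta>) (n + 1) xs = CE sU \<mu>\<^sub>U \<mu>\<^sub>U n (on_mu \<theta> n) xs"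
  proof (cases "length xs = n + 1")
    case True
    then have "on_mu (l1 sU sV \<beta> \<theta>) (n + 1) xs = linear_extension sU
        (\<lambda>t. \<Sum>v\<in>vertices_B t. eval_B (\<lambda>p. if p = v then \<theta> else \<beta>) ((!) xs) t)
        (infinitesimal_sum Mu Mu In_B 2 (n + 1))"
      by (simp add: l1_def bd_mu_def)
    also have "\<dots> = CE sU \<mu>\<^sub>U \<mu>\<^sub>U n (on_mu \<theta> n) xs"
      by (rule dom.linear_extension_CE[where \<psi> = "on_mu \<beta>"])
        (use n True in \<open>simp_all add: vertices_B_graft eval_B_graft eval_B_corolla theta_supp beta_supp
          theta_zero_Cons beta_zero_Cons beta_values del: vertices_B.simps eval_B.simps\<close>)
    finally show ?thesis .
  qed (simp add: l1_def CE_def)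
qed

lemma l1_nu: "on_nu (l1 sU sV \<beta> \<theta>) (n + 1) = CE sV \<mu>\<^sub>V \<mu>\<^sub>V n (on_nu \<theta> n)"
proof
  fix xs
  show "on_nu (l1 sU sV \<beta> \<theta>) (n + 1) xs = CE sV \<mu>\<^sub>V \<mu>\<^sub>V n (on_nu \<theta> n) xs"
  proof (cases "length xs = n + 1")
    case True
    then have "on_nu (l1 sU sV \<beta> \<theta>) (n + 1) xs = linear_extension sV
        (\<lambda>t. \<Sum>v\<in>vertices_W t. eval_W (\<lambda>p. if p = v then \<theta> else \<beta>) (\<lambda>_. 0) ((!) xs) t)
        (infinitesimal_sum Nu Nu In_W 2 (n + 1))"
      by (simp add: l1_def bd_nu_def)
    also have "\<dots> = CE sV \<mu>\<^sub>V \<mu>\<^sub>V n (on_nu \<theta> n) xs"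
      by (rule cod.linear_extension_CE[where \<psi> = "on_nu \<beta>"])
        (use n True in \<open>simp_all add: vertices_W_graft_Nu eval_W_graft_Nu eval_W_corolla_Nu theta_supp
          beta_supp theta_zero_Cons beta_zero_Cons beta_values del: vertices_W.simps eval_W.simps\<close>)
    finally show ?thesis .
  qed (simp add: l1_def CE_def)
qed

text \<open>With \<theta> at the root only \<open>f\<close> of arity \<open>n - 1\<close> over the
  bracket survives. With \<theta> inside, the root is \<open>f\<^sub>1\<close> and the only
  \<open>(n, 0)\<close>-unshuffle is the identity.\<close>

lemma l1_f_infinitesimal:
  assumes len: "length xs = n"
  shows "linear_extension sV
      (\<lambda>t. \<Sum>v\<in>vertices_W t. eval_W (\<lambda>p. if p = v then \<theta> else \<beta>) ((!) xs) y t)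
      (infinitesimal_sum F Mu In_B 1 n) =
    (\<Sum>(s, t)\<in>{(s, t). 1 \<le> s \<and> s < t \<and> t \<le> n}. sV ((-1) ^ (s + t - 1))
       (on_f \<theta> (n - 1) (\<mu>\<^sub>U (xs ! (s - 1)) (xs ! (t - 1)) # nths xs (- {s - 1, t - 1})))) +
    g (on_mu \<theta> n xs)"
proof -
  have m: "n - 1 - 1 + 2 = n" using n by simp
  have "linear_extension sV
      (\<lambda>t. \<Sum>v\<in>vertices_W t. eval_W (\<lambda>p. if p = v then \<theta> else \<beta>) ((!) xs) y t)
      (infinitesimal_sum F Mu In_B 1 n) =
    (\<Sum>\<sigma>\<in>unshuffles [2, n - 1 - 1]. sV (of_int (sign \<sigma>))
       (on_f \<theta> (n - 1) (on_mu \<beta> 2 [xs ! \<sigma> 0, xs ! \<sigma> 1] # map (\<lambda>a. xs ! \<sigma> a) [2..<n]))) +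
    (\<Sum>\<sigma>\<in>unshuffles [n, 1 - 1]. sV ((-1) ^ (n * (1 - 1)) * of_int (sign \<sigma>))
       (on_f \<beta> 1 (on_mu \<theta> n (map (\<lambda>a. xs ! \<sigma> a) [0..<n]) # map (\<lambda>a. xs ! \<sigma> a) [n..<n])))"
    \<comment> \<open>The instance is \<open>p = n - 1\<close>, \<open>k = 1\<close> and
      \<open>m = n\<close>.\<close>
    by (rule cod.linear_extension_infinitesimal_sum)
      (use n in \<open>simp_all add: vertices_W_graft_F eval_W_graft_F eval_B_corolla theta_supp beta_supp
        theta_zero_Cons[unfolded One_nat_def] beta_zero_Cons[unfolded One_nat_def] del: vertices_W.simps eval_B.simps eval_W.simps\<close>)
  also have "(\<Sum>\<sigma>\<in>unshuffles [2, n - 1 - 1]. sV (of_int (sign \<sigma>))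
       (on_f \<theta> (n - 1) (on_mu \<beta> 2 [xs ! \<sigma> 0, xs ! \<sigma> 1] # map (\<lambda>a. xs ! \<sigma> a) [2..<n]))) =
    (\<Sum>(s, t)\<in>{(s, t). 1 \<le> s \<and> s < t \<and> t \<le> n}. sV ((-1) ^ (s + t - 1))
       (on_f \<theta> (n - 1) (\<mu>\<^sub>U (xs ! (s - 1)) (xs ! (t - 1)) # nths xs (- {s - 1, t - 1}))))"
    using cod.sum_unshuffles_2_nths[of xs "n - 1 - 1" "\<lambda>x y zs. on_f \<theta> (n - 1) (\<mu>\<^sub>U x y # zs)"] len
    by (simp only: m beta_values)
  also have "(\<Sum>\<sigma>\<in>unshuffles [n, 1 - 1]. sV ((-1) ^ (n * (1 - 1)) * of_int (sign \<sigma>))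
       (on_f \<beta> 1 (on_mu \<theta> n (map (\<lambda>a. xs ! \<sigma> a) [0..<n]) # map (\<lambda>a. xs ! \<sigma> a) [n..<n]))) =
    g (on_mu \<theta> n xs)"
    using len by (auto simp: unshuffles_0 beta_def map_nth)
  finally show ?thesis .
qed

text \<open>With \<theta> at the root the support forces \<open>l = n\<close>; \<open>n\<close>
  positive parts with sum \<open>n\<close> are all \<open>1\<close>, so each child is
  \<open>g\<close>.\<close>

lemma l1_f_compositions:
  assumes len: "length xs = n"
  shows "(\<Sum>l\<in>{2..n}. \<Sum>r\<in>{r. length r = l \<and> sum_list r = n \<and> sorted r \<and> (\<forall>a\<in>set r. 1 \<le> a)}.
      \<Sum>\<sigma>\<in>ordered_unshuffles r.
        sV ((-1) ^ (l * (l - 1) div 2 + (\<Sum>i\<in>{1..l-1}. r ! (i - 1) * (l - i))) * of_int (sign \<sigma>))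
          (on_nu \<theta> l (map (\<lambda>k. on_f \<beta> (block_start r (k + 1) - block_start r k)
            (map (\<lambda>a. xs ! \<sigma> a) [block_start r k..<block_start r (k + 1)])) [0..<l]))) =
    on_nu \<theta> n (map g xs)" (is "(\<Sum>l\<in>_. ?S l) = _")
proof -
  have "(\<Sum>l\<in>{2..n}. ?S l) = (\<Sum>l\<in>{n}. ?S l)"
    using n by (intro sum.mono_neutral_right) (auto simp: theta_supp)
  also have "\<dots> = ?S n" by simp
  also have "{r. length r = n \<and> sum_list r = n \<and> sorted r \<and> (\<forall>a\<in>set r. 1 \<le> a)} = {replicate n 1}"
    using sum_list_eq_length_iff by (auto simp: sum_list_replicate)
  also have "(\<Sum>r\<in>{replicate n 1}. \<Sum>\<sigma>\<in>ordered_unshuffles r.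
        sV ((-1) ^ (n * (n - 1) div 2 + (\<Sum>i\<in>{1..n-1}. r ! (i - 1) * (n - i))) * of_int (sign \<sigma>))
          (on_nu \<theta> n (map (\<lambda>k. on_f \<beta> (block_start r (k + 1) - block_start r k)
            (map (\<lambda>a. xs ! \<sigma> a) [block_start r k..<block_start r (k + 1)])) [0..<n]))) =
    on_nu \<theta> n (map (\<lambda>k. on_f \<beta> (block_start (replicate n 1) (k + 1) - block_start (replicate n 1) k)
      (map (\<lambda>a. xs ! a) [block_start (replicate n 1) k..<block_start (replicate n 1) (k + 1)])) [0..<n])"
    by (simp only: sum.insert finite.emptyI sum.empty empty_iff not_False_eq_True add_0_right
      ordered_unshuffles_replicate_1 minus_one_power_iff bd_f_corolla_sign) simp
  also have "map (\<lambda>k. on_f \<beta> (block_start (replicate n 1) (k + 1) - block_start (replicate n 1) k)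
      (map (\<lambda>a. xs ! a) [block_start (replicate n 1) k..<block_start (replicate n 1) (k + 1)])) [0..<n] =
    map g xs"
  proof (rule nth_equalityI)
    fix k assume "k < length (map (\<lambda>k. on_f \<beta> (block_start (replicate n 1) (k + 1) - block_start (replicate n 1) k)
      (map (\<lambda>a. xs ! a) [block_start (replicate n 1) k..<block_start (replicate n 1) (k + 1)])) [0..<n])"
    then have "k < n" by simp
    then show "map (\<lambda>k. on_f \<beta> (block_start (replicate n 1) (k + 1) - block_start (replicate n 1) k)
      (map (\<lambda>a. xs ! a) [block_start (replicate n 1) k..<block_start (replicate n 1) (k + 1)])) [0..<n] ! k = map g xs ! k"
      using len block_start_replicate_1[of k n] block_start_replicate_1[of "Suc k" n]
      by (simp add: beta_def)
  qed (simp add: len)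
  finally show ?thesis .
qed

text \<open>A root decorated by \<beta> is binary, so one child carries \<theta> and the other
  \<open>g\<close>. Sortedness puts the part \<open>1\<close> first, and the exponent
  \<open>1 + 1\<close> is even.\<close>

lemma l1_f_binary:
  assumes len: "length xs = n"
  shows "(\<Sum>l\<in>{2..n}. \<Sum>r\<in>{r. length r = l \<and> sum_list r = n \<and> sorted r \<and> (\<forall>a\<in>set r. 1 \<le> a)}.
      \<Sum>\<sigma>\<in>ordered_unshuffles r.
        sV ((-1) ^ (l * (l - 1) div 2 + (\<Sum>i\<in>{1..l-1}. r ! (i - 1) * (l - i))) * of_int (sign \<sigma>))
          (\<Sum>k<l. on_nu \<beta> l (map (\<lambda>j. on_f (if j = k then \<theta> else \<beta>)
            (block_start r (j + 1) - block_start r j)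
            (map (\<lambda>a. xs ! \<sigma> a) [block_start r j..<block_start r (j + 1)])) [0..<l]))) =
    (\<Sum>s\<in>{1..n}. sV ((-1) ^ (s - 1)) (\<mu>\<^sub>V (g (xs ! (s - 1))) (on_f \<theta> (n - 1) (nths xs (- {s - 1})))))"
    (is "(\<Sum>l\<in>_. ?S l) = ?R")
proof -
  let ?C = "{r. length r = 2 \<and> sum_list r = n \<and> sorted r \<and> (\<forall>a\<in>set r. 1 \<le> a)}"
  \<comment> \<open>The two summands place \<theta> at the left and at the right child.\<close>
  define K where "K = (\<lambda>r \<sigma>. 
      \<mu>\<^sub>V (on_f \<theta> (r ! 0) (map (\<lambda>a. xs ! \<sigma> a) [0..<r ! 0])) (on_f \<beta> (r ! 1) (map (\<lambda>a. xs ! \<sigma> a) [r ! 0..<n])) +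
      \<mu>\<^sub>V (on_f \<beta> (r ! 0) (map (\<lambda>a. xs ! \<sigma> a) [0..<r ! 0])) (on_f \<theta> (r ! 1) (map (\<lambda>a. xs ! \<sigma> a) [r ! 0..<n])))"
  have "(\<Sum>l\<in>{2..n}. ?S l) = (\<Sum>l\<in>{2}. ?S l)"
    using n by (intro sum.mono_neutral_right) (auto simp: beta_supp)
  also have "\<dots> = ?S 2" by simp
  also have "\<dots> = (\<Sum>r\<in>?C. \<Sum>\<sigma>\<in>ordered_unshuffles r.
      sV ((-1) ^ (1 + r ! 0) * of_int (sign \<sigma>)) (K r \<sigma>))"
  proof (intro sum.cong refl)
    fix r and \<sigma> :: "nat \<Rightarrow> nat" assume "r \<in> ?C"
    then obtain a b where r: "r = [a, b]" "a + b = n" by (rule bd_f_pair_compositions)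
    have "[0..<2] = [0, Suc 0]" "{..<2} = {0, Suc 0}" by (auto simp: upt_rec)
    then show "sV ((-1) ^ (2 * (2 - 1) div 2 + (\<Sum>i\<in>{1..2-1}. r ! (i - 1) * (2 - i))) * of_int (sign \<sigma>))
          (\<Sum>k<2. on_nu \<beta> 2 (map (\<lambda>j. on_f (if j = k then \<theta> else \<beta>)
            (block_start r (j + 1) - block_start r j)
            (map (\<lambda>a. xs ! \<sigma> a) [block_start r j..<block_start r (j + 1)])) [0..<2])) =
      sV ((-1) ^ (1 + r ! 0) * of_int (sign \<sigma>)) (K r \<sigma>)"
      using r(2)[symmetric] by (simp add: r(1) K_def block_start_def beta_values)
  qed
  also have "\<dots> = (\<Sum>r\<in>{[1, n - 1]}. \<Sum>\<sigma>\<in>ordered_unshuffles r.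
      sV ((-1) ^ (1 + r ! 0) * of_int (sign \<sigma>)) (K r \<sigma>))"
  proof (rule sum.mono_neutral_right[OF finite_bd_f_pair_compositions])
    show "\<forall>r\<in>?C - {[1, n - 1]}. (\<Sum>\<sigma>\<in>ordered_unshuffles r.
      sV ((-1) ^ (1 + r ! 0) * of_int (sign \<sigma>)) (K r \<sigma>)) = 0"
    proof
      fix r assume r: "r \<in> ?C - {[1, n - 1]}"
      then obtain a b where ab: "r = [a, b]" "a + b = n" "1 \<le> a" "a \<le> b"
        by (elim DiffE bd_f_pair_compositions)
      \<comment> \<open>\<open>a = 1\<close> would give the excluded composition and
        \<open>b = 1\<close> forces \<open>a = 1\<close>; without a part \<open>1\<close>,
        \<open>g\<close> fits at neither child.\<close>
      then have "a \<noteq> 1" "b \<noteq> 1" using r by auto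
      then have "K r \<sigma> = 0" for \<sigma>
        by (simp add: K_def ab(1) beta_supp)
      then show "(\<Sum>\<sigma>\<in>ordered_unshuffles r. sV ((-1) ^ (1 + r ! 0) * of_int (sign \<sigma>)) (K r \<sigma>)) = 0"
        by simp
    qed
  qed (use n in auto)
  also have "\<dots> = (\<Sum>\<sigma>\<in>ordered_unshuffles [1, n - 1]. sV (of_int (sign \<sigma>)) (K [1, n - 1] \<sigma>))"
    by simp
  also have "\<dots> = ?R"
  proof (cases "n = 2")
    \<comment> \<open>Here the only tree is \<open>\<nu>\<^sub>2(f\<^sub>1 \<otimes> f\<^sub>1)\<close> with the identity unshuffle, and decorating its left resp.
      right input vertex by \<open>\<theta>\<close> gives the terms \<open>s = 2\<close> resp. \<open>s = 1\<close>.\<close>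
    case True
    then obtain u v where xs: "xs = [u, v]"
      using len by (auto simp: numeral_2_eq_2 length_Suc_conv)
    have "{1..2::nat} = {1, 2}" by auto
    moreover have "[Suc 0..<2] = [Suc 0]" by (simp add: upt_rec)
    moreover have "ordered_unshuffles [1, 1] = {id}"
      using ordered_unshuffles_replicate_1[of 2] by (simp add: numeral_2_eq_2)
    ultimately show ?thesis
      using cod.bracket_antisym[of "g v" "on_f \<theta> (Suc 0) [u]"]
      by (simp add: True xs K_def nths_Cons beta_def)
  next
    case False
    then have "n - 1 \<noteq> 1" by simp
    \<comment> \<open>The other summand of \<open>K\<close> has \<theta> on
      \<open>f\<^sub>1\<close>, which vanishes since \<open>n - 1\<close> differs from
      \<open>1\<close>.\<close>
    then have "K [1, n - 1] \<sigma> = \<mu>\<^sub>V (g (xs ! \<sigma> 0)) (on_f \<theta> (n - 1) (map (\<lambda>a. xs ! \<sigma> a) [1..<n]))" for \<sigma>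
      using theta_supp(3)[of 1] by (simp add: K_def beta_def)
    moreover have "ordered_unshuffles [1, n - 1] = unshuffles [1, n - 1]"
      using \<open>n - 1 \<noteq> 1\<close> by (rule ordered_unshuffles_1)
    moreover have "n - 1 + 1 = n" using n by simp
    ultimately show ?thesis
      using cod.sum_unshuffles_1_nths[of xs "n - 1" "\<lambda>x zs. \<mu>\<^sub>V (g x) (on_f \<theta> (n - 1) zs)"] len
      by simp
  qed
  finally show ?thesis .
qed

text \<open>The boundary of \<open>f\<^sub>n\<close> subtracts the infinitesimal sum, whence the
  minus signs of the bracket part and of \<open>g \<theta>\<^sub>U\<close>. The action part arrives
  with \<open>(-1) ^ (s - 1)\<close>, opposite to \<open>CE\<close>, so
  \<open>b \<theta>\<^sub>g\<close> as a whole gets a minus sign.\<close>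

lemma l1_f:
  "on_f (l1 sU sV \<beta> \<theta>) n =
    (\<lambda>xs. - CE sV \<mu>\<^sub>U (\<lambda>x v. \<mu>\<^sub>V (g x) v) (n - 1) (on_f \<theta> (n - 1)) xs + on_nu \<theta> n (map g xs) - g (on_mu \<theta> n xs))"
proof
  fix xs
  show "on_f (l1 sU sV \<beta> \<theta>) n xs = - CE sV \<mu>\<^sub>U (\<lambda>x v. \<mu>\<^sub>V (g x) v) (n - 1) (on_f \<theta> (n - 1)) xs +
    on_nu \<theta> n (map g xs) - g (on_mu \<theta> n xs)"
  proof (cases "length xs = n")
    case True
    let ?e = "\<lambda>t. \<Sum>v\<in>vertices_W t. eval_W (\<lambda>p. if p = v then \<theta> else \<beta>) ((!) xs) (\<lambda>_. 0) t"
    let ?X = "\<Sum>s\<in>{1..n}. sV ((-1) ^ s) (\<mu>\<^sub>V (g (xs ! (s - 1))) (on_f \<theta> (n - 1) (nths xs (- {s - 1}))))"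
    let ?Y = "\<Sum>(s, t)\<in>{(s, t). 1 \<le> s \<and> s < t \<and> t \<le> n}. sV ((-1) ^ (s + t - 1))
       (on_f \<theta> (n - 1) (\<mu>\<^sub>U (xs ! (s - 1)) (xs ! (t - 1)) # nths xs (- {s - 1, t - 1})))"
    have "on_f (l1 sU sV \<beta> \<theta>) n xs = linear_extension sV ?e (bd_f n)"
      using True by (simp add: l1_def)
    also have "\<dots> = on_nu \<theta> n (map g xs) +
      (\<Sum>s\<in>{1..n}. sV ((-1) ^ (s - 1)) (\<mu>\<^sub>V (g (xs ! (s - 1))) (on_f \<theta> (n - 1) (nths xs (- {s - 1}))))) -
      (?Y + g (on_mu \<theta> n xs))"
      unfolding bd_f_def cod.linear_extension_diff l1_f_infinitesimal[OF True]
        cod.linear_extension_sum cod.linear_extension_single sum_eval_W_Nu_F[OF refl]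
        cod.scale_right_distrib sum.distrib length_upt
        l1_f_compositions[OF True] l1_f_binary[OF True] by (rule refl)
    also have "(\<Sum>s\<in>{1..n}. sV ((-1) ^ (s - 1)) (\<mu>\<^sub>V (g (xs ! (s - 1))) (on_f \<theta> (n - 1) (nths xs (- {s - 1}))))) = - ?X"
      unfolding sum_negf[symmetric]
    proof (rule sum.cong[OF refl])
      fix s assume "s \<in> {1..n}"
      then obtain r where "s = Suc r" by (cases s) auto
      then show "sV ((-1) ^ (s - 1)) (\<mu>\<^sub>V (g (xs ! (s - 1))) (on_f \<theta> (n - 1) (nths xs (- {s - 1})))) =
        - sV ((-1) ^ s) (\<mu>\<^sub>V (g (xs ! (s - 1))) (on_f \<theta> (n - 1) (nths xs (- {s - 1}))))"
        by simp
    qed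
    finally have "on_f (l1 sU sV \<beta> \<theta>) n xs =
      on_nu \<theta> n (map g xs) + - ?X - (?Y + g (on_mu \<theta> n xs))" .
    moreover have "CE sV \<mu>\<^sub>U (\<lambda>x v. \<mu>\<^sub>V (g x) v) (n - 1) (on_f \<theta> (n - 1)) xs = ?X + ?Y"
    proof -
      have "n - 1 + 1 = n" using n by simp
      then show ?thesis unfolding CE_def using True by simp
    qed
    ultimately show ?thesis by simp
  next
    case False
    moreover have "length xs \<noteq> n - 1 + 1" using n False by simp
    \<comment> \<open>Off their arity all operations are normalised to zero, and \<open>g\<close>
      preserves zero.\<close>
    ultimately show ?thesis
      using theta_Hom_wedge(1,2) by (simp add: l1_def CE_def Hom_wedge_def g_zero)
  qed
qed

end

theorem theorem7p5:
  fixes sU :: "'k::field_char_0 \<Rightarrow> 'u::ab_group_add \<Rightarrow> 'u"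
    and sV :: "'k \<Rightarrow> 'v::ab_group_add \<Rightarrow> 'v"
    and \<mu>\<^sub>U :: "'u \<Rightarrow> 'u \<Rightarrow> 'u" and \<mu>\<^sub>V :: "'v \<Rightarrow> 'v \<Rightarrow> 'v"
    and g :: "'u \<Rightarrow> 'v" and n :: nat
    and \<theta> :: "('u, 'v) gen_map"
    and \<theta>\<^sub>U :: "'u list \<Rightarrow> 'u" and \<theta>\<^sub>V :: "'v list \<Rightarrow> 'v" and \<theta>\<^sub>g :: "'u list \<Rightarrow> 'v"
  assumes "lie_algebra sU \<mu>\<^sub>U" and "lie_algebra sV \<mu>\<^sub>V"
    and "lie_morphism sU \<mu>\<^sub>U sV \<mu>\<^sub>V g"
    and "n \<ge> 2"
    and "\<theta> \<in> cochains sU sV (n - 1)"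
    and "to_Lambda (n - 1) \<theta> = (\<theta>\<^sub>U, \<theta>\<^sub>V, \<theta>\<^sub>g)"
  shows "delta sU \<mu>\<^sub>U sV \<mu>\<^sub>V g n (\<theta>\<^sub>U, \<theta>\<^sub>V, \<theta>\<^sub>g) =
    (CE sU \<mu>\<^sub>U \<mu>\<^sub>U n \<theta>\<^sub>U,
     CE sV \<mu>\<^sub>V \<mu>\<^sub>V n \<theta>\<^sub>V,
     (\<lambda>xs. - CE sV \<mu>\<^sub>U (\<lambda>x v. \<mu>\<^sub>V (g x) v) (n - 1) \<theta>\<^sub>g xs + \<theta>\<^sub>V (map g xs) - g (\<theta>\<^sub>U xs)))"
proof -
  \<comment> \<open>By injectivity the inverse taken in \<open>delta\<close> returns the given
    \<theta>, so the component formulas apply.\<close>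
  have "inj_on (to_Lambda (n - 1)) (cochains sU sV (n - 1))"
    using to_Lambda_bij[of "n - 1" sU sV] assms(4) by (simp add: bij_betw_def)
  then have "the_inv_into (cochains sU sV (n - 1)) (to_Lambda (n - 1)) (\<theta>\<^sub>U, \<theta>\<^sub>V, \<theta>\<^sub>g) = \<theta>"
    using assms(5,6) by (metis the_inv_into_f_f)
  moreover have "on_mu \<theta> n = \<theta>\<^sub>U" "on_nu \<theta> n = \<theta>\<^sub>V" "on_f \<theta> (n - 1) = \<theta>\<^sub>g"
    using assms(4,6) by (simp_all add: to_Lambda_def)
  ultimately show ?thesis
    using l1_mu[OF assms(3-5)] l1_nu[OF assms(3-5)] l1_f[OF assms(3-5)]
    by (simp add: delta_def to_Lambda_def)
qed

end
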